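(* Let $(a(n))_{n\geqslant 1}$ be real with $a(n)\geqslant 0$ for all $n$ and $|A|=\sum_{n\geqslant 1}a(n)<\infty$. Let $\mathbb{P}$ be a set of primes, for $z\geqslant 2$ let $P(z)=\prod_{p\in\mathbb{P},\,p<z}p$, and let $S(A,\mathbb{P},z)=\sum_{n\geqslant 1,\,(n,P(z))=1}a(n)$. For every $n\geqslant 1$ let $g_n$ be a multiplicative function with $0\leqslant g_n(p)<1$ for all $p\in\mathbb{P}$, and define $r(d)$ by $$\sum_{n\geqslant 1,\ d\mid n}a(n)=\sum_{n\geqslant 1}a(n)g_n(d)+r(d).$$ Let $\mathbb{Q}\subseteq\mathbb{P}$ be a finite set of primes and $Q$ the product of its elements. Suppose that for some $\epsilon$ with $0<\epsilon<1/200$, $$\prod_{\substack{p\in\mathbb{P}\setminus\mathbb{Q}\\ u\leqslant p<z}}(1-g_n(p))^{-1}\leqslant(1+\epsilon)\frac{\log z}{\log u}$$ for all $n$ and all $1<u<z$. Put $s=\frac{\log D}{\log z}$, $X=\sum_{n\geqslant 1}a(n)\prod_{p\mid P(z)}(1-g_n(p))$, and $R=\sum_{d\mid P(z),\ d<QD}|r(d)|$. Then for any $D\geqslant z$, $$S(A,\mathbb{P},z)<\left(F(s)+164\,\epsilon e^2h(s)\right)X+R,$$ and for any $D\geqslant z^2$, $$S(A,\mathbb{P},z)>\left(f(s)-162\,\epsilon e^2h(s)\right)X-R.$$ Moreover, if there is a multiplicative function $g$ with $g_n=g$ for all $n$, then $X=V(z)|A|$ where $V(z)=\prod_{p\mid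 P(z)}(1-g(p))$.
   Context: The functions $f_n$ ($n\geqslant 1$): $f_n(s)=0$ for $s\geqslant n+2$; $sf_1(s)=3-s$ for $1\leqslant s\leqslant 3$; $(sf_n(s))'=-f_{n-1}(s-1)$ for $n\geqslant 2$ even and $s\geqslant 2$; $(sf_n(s))'=-f_{n-1}(s-1)$ for $n\geqslant 2$ odd and $s\geqslant 3$; $(sf_n(s))'=0$ for $n\geqslant 2$ odd and $1\leqslant s\leqslant 3$. The sieve functions are $F(s)=1+\sum_{n\text{ odd}}f_n(s)$ for $s\geqslant 1$ and $f(s)=1-\sum_{n\text{ even}}f_n(s)$ for $s\geqslant 2$. $h(s)=e^{-2}$ for $1\leqslant s\leqslant 2$, $e^{-s}$ for $2\leqslant s\leqslant 3$, $3s^{-1}e^{-s}$ for $s\geqslant 3$.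
   Formalization: The two strict bounds on S(A,P,z) are stated under the extra assumption |A| > 0, because when a(n) = 0 for all n they would read 0 < 0 and 0 > 0; the final claim X = V(z)|A| needs no such assumption. *)

theory Defs
  imports "HOL-Analysis.Analysis" "HOL-Computational_Algebra.Primes"
begin

text \<open>
  The functions \<open>f\<^sub>n\<close> of the linear sieve are given by their system of differential equations.
  Derivatives are taken within the stated ranges, hence one-sided at the end points: for odd
  \<open>n \<ge> 3\<close> the left and right derivatives of \<open>s f\<^sub>n(s)\<close> at \<open>s = 3\<close> differ, and for even \<open>n\<close>
  nothing is said to the left of \<open>s = 2\<close>. Differentiability within each range makes \<open>f\<^sub>n\<close>
  continuous there, so together with the vanishing for \<open>s \<ge> n + 2\<close> the conditions determine
  \<open>f\<^sub>n\<close> on \<open>[1, \<infinity>)\<close> (\<open>n\<close> odd) and on \<open>[2, \<infinity>)\<close> (\<open>n\<close> even).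
\<close>

definition linear_sieve_system :: "(nat \<Rightarrow> real \<Rightarrow> real) \<Rightarrow> bool" where
  "linear_sieve_system f \<longleftrightarrow>
     (\<forall>n\<ge>1. \<forall>s\<ge>real n + 2. f n s = 0) \<and>
     (\<forall>s. 1 \<le> s \<and> s \<le> 3 \<longrightarrow> s * f 1 s = 3 - s) \<and>
     (\<forall>n\<ge>2. even n \<longrightarrow> (\<forall>s\<ge>2.
        ((\<lambda>t. t * f n t) has_real_derivative - f (n - 1) (s - 1)) (at s within {2..}))) \<and>
     (\<forall>n\<ge>2. odd n \<longrightarrow> (\<forall>s\<ge>3.
        ((\<lambda>t. t * f n t) has_real_derivative - f (n - 1) (s - 1)) (at s within {3..}))) \<and>
     (\<forall>n\<ge>2. odd n \<longrightarrow> (\<forall>s. 1 \<le> s \<and> s \<le> 3 \<longrightarrow>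
        ((\<lambda>t. t * f n t) has_real_derivative 0) (at s within {1..3})))"

definition upper_sieve_fun :: "(nat \<Rightarrow> real \<Rightarrow> real) \<Rightarrow> real \<Rightarrow> real" where
  "upper_sieve_fun f s = 1 + (\<Sum>\<^sub>\<infinity>n\<in>{n. n \<ge> 1 \<and> odd n}. f n s)"

definition lower_sieve_fun :: "(nat \<Rightarrow> real \<Rightarrow> real) \<Rightarrow> real \<Rightarrow> real" where
  "lower_sieve_fun f s = 1 - (\<Sum>\<^sub>\<infinity>n\<in>{n. n \<ge> 1 \<and> even n}. f n s)"

text \<open>Only used for \<open>s \<ge> 1\<close>.\<close>

definition sieve_h :: "real \<Rightarrow> real" where
  "sieve_h s = (if s \<le> 2 then exp (-2) else if s \<le> 3 then exp (- s) else 3 * inverse s * exp (- s))"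

definition multiplicative_fun :: "(nat \<Rightarrow> real) \<Rightarrow> bool" where
  "multiplicative_fun g \<longleftrightarrow>
     g 1 = 1 \<and> (\<forall>m n. m \<ge> 1 \<and> n \<ge> 1 \<and> coprime m n \<longrightarrow> g (m * n) = g m * g n)"

definition sieve_prod :: "nat set \<Rightarrow> real \<Rightarrow> nat" where
  "sieve_prod P z = \<Prod>{p \<in> P. real p < z}"

definition sifted_sum :: "(nat \<Rightarrow> real) \<Rightarrow> nat set \<Rightarrow> real \<Rightarrow> real" where
  "sifted_sum a P z = (\<Sum>\<^sub>\<infinity>n\<in>{n. n \<ge> 1 \<and> coprime n (sieve_prod P z)}. a n)"

definition total_mass :: "(nat \<Rightarrow> real) \<Rightarrow> real" where
  "total_mass a = (\<Sum>\<^sub>\<infinity>n\<in>{1..}. a n)"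

definition sieve_remainder :: "(nat \<Rightarrow> real) \<Rightarrow> (nat \<Rightarrow> nat \<Rightarrow> real) \<Rightarrow> nat \<Rightarrow> real" where
  "sieve_remainder a g d =
     (\<Sum>\<^sub>\<infinity>n\<in>{n. n \<ge> 1 \<and> d dvd n}. a n) - (\<Sum>\<^sub>\<infinity>n\<in>{1..}. a n * g n d)"

definition sieve_density :: "(nat \<Rightarrow> real) \<Rightarrow> nat set \<Rightarrow> real \<Rightarrow> real" where
  "sieve_density g P z = (\<Prod>p\<in>{p. prime p \<and> p dvd sieve_prod P z}. 1 - g p)"

definition sieve_main_term ::
  "(nat \<Rightarrow> real) \<Rightarrow> (nat \<Rightarrow> nat \<Rightarrow> real) \<Rightarrow> nat set \<Rightarrow> real \<Rightarrow> real" where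
  "sieve_main_term a g P z = (\<Sum>\<^sub>\<infinity>n\<in>{1..}. a n * sieve_density (g n) P z)"

definition sieve_error ::
  "(nat \<Rightarrow> real) \<Rightarrow> (nat \<Rightarrow> nat \<Rightarrow> real) \<Rightarrow> nat set \<Rightarrow> nat set \<Rightarrow> real \<Rightarrow> real \<Rightarrow> real" where
  "sieve_error a g P Q z D =
     (\<Sum>d\<in>{d. d dvd sieve_prod P z \<and> real d < real (\<Prod>Q) * D}. \<bar>sieve_remainder a g d\<bar>)"

text \<open>
  The system is solvable: \<open>t f\<^sub>n(t)\<close> is obtained by integrating the previous function from
  the upper end point \<open>n + 2\<close> of its range down to \<open>t\<close>.
\<close>

primrec linear_sieve_sol :: "nat \<Rightarrow> real \<Rightarrow> real" where
  "linear_sieve_sol 0 s = 0"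
| "linear_sieve_sol (Suc m) s =
     (if m = 0 then max 0 (3 - s) / s
      else let c = (if even m then 3 else 2); u = (\<lambda>t. linear_sieve_sol m (t - 1)) in
        (integral {c..real m + 3} u - integral {c..max s c} u) / s)"

lemma linear_sieve_sol_step:
  fixes u :: "real \<Rightarrow> real" and b c :: real
  assumes cont: "continuous_on {c..} u" and c: "c \<ge> 2" and cb: "c \<le> b"
    and zero: "\<And>t. t \<ge> b \<Longrightarrow> u t = 0"
  defines "\<phi> \<equiv> \<lambda>s. (integral {c..b} u - integral {c..max s c} u) / s"
  shows "s \<ge> c \<Longrightarrow> ((\<lambda>t. t * \<phi> t) has_real_derivative - u s) (at s within {c..})"
    and "1 \<le> s \<Longrightarrow> s \<le> c \<Longrightarrow> ((\<lambda>t. t * \<phi> t) has_real_derivative 0) (at s within {1..c})"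
    and "continuous_on {1..} \<phi>"
    and "s \<ge> b \<Longrightarrow> \<phi> s = 0"
proof -
  define I where "I = (\<lambda>s. integral {c..s} u)"
  have eq: "t * \<phi> t = I b - I (max t c)" if "t \<ge> 1" for t
    using that by (simp add: \<phi>_def I_def)
  have DI: "(I has_real_derivative u s) (at s within {c..})" if "s \<ge> c" for s
  proof -
    have "(I has_real_derivative u s) (at s within {c..s + 1})"
      unfolding I_def
      by (rule integral_has_real_derivative)
         (use that cont in \<open>auto intro: continuous_on_subset\<close>)
    moreover have "at s within {c..s + 1} = at s within {c..}"
      by (rule at_within_nhd[of _ "{..<s + 1}"]) auto
    ultimately show ?thesis by simp
  qed
  show "((\<lambda>t. t * \<phi> t) has_real_derivative - u s) (at s within {c..})" if "s \<ge> c" for s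
  proof (rule has_field_derivative_transform_within[where f = "\<lambda>t. I b - I t" and d = 1])
    show "((\<lambda>t. I b - I t) has_real_derivative - u s) (at s within {c..})"
      using DI[OF that] by (auto intro!: derivative_eq_intros)
  qed (use that c eq in \<open>auto simp: max_def\<close>)
  show "((\<lambda>t. t * \<phi> t) has_real_derivative 0) (at s within {1..c})"
    if "1 \<le> s" "s \<le> c" for s
  proof (rule has_field_derivative_transform_within[where f = "\<lambda>t. I b - I c" and d = 1])
    show "((\<lambda>t. I b - I c) has_real_derivative 0) (at s within {1..c})"
      by (auto intro!: derivative_eq_intros)
  qed (use that c eq in \<open>auto simp: max_def\<close>)
  have cI: "continuous_on {c..} I"
    using DI by (meson DERIV_continuous_on atLeast_iff)
  have "continuous_on {1..} (\<lambda>t. I (max t c))"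
    by (rule continuous_on_compose2[OF cI]) (auto intro!: continuous_intros)
  then have "continuous_on {1..} (\<lambda>t. (I b - I (max t c)) / t)"
    by (auto intro!: continuous_intros)
  then show "continuous_on {1..} \<phi>"
    by (simp add: \<phi>_def I_def)
  show "\<phi> s = 0" if "s \<ge> b" for s
  proof -
    have "integral {c..b} u + integral {b..s} u = integral {c..s} u"
      by (rule Henstock_Kurzweil_Integration.integral_combine)
         (use that cb cont in \<open>auto intro!: integrable_continuous_real intro: continuous_on_subset\<close>)
    moreover have "integral {b..s} u = 0"
      using zero by (intro integral_unique has_integral_is_0) auto
    ultimately show ?thesis using that cb by (simp add: \<phi>_def)
  qed
qed

lemma linear_sieve_sol_aux:
  assumes "n \<ge> 1"
  shows "continuous_on {1..} (linear_sieve_sol n) \<and> (\<forall>s\<ge>real n + 2. linear_sieve_sol n s = 0)"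
  using assms
proof (induction n rule: dec_induct)
  case base
  have "continuous_on {1..} (\<lambda>s::real. max 0 (3 - s) / s)"
    by (auto intro!: continuous_intros)
  then show ?case by (auto simp: max_def)
next
  case (step m)
  define c :: real where "c = (if even m then 3 else 2)"
  define u where "u = (\<lambda>t. linear_sieve_sol m (t - 1))"
  have u: "continuous_on {c..} u" "\<And>t. t \<ge> real m + 3 \<Longrightarrow> u t = 0"
    unfolding u_def using step.IH
    by (auto intro!: continuous_on_compose2[of "{1..}" "linear_sieve_sol m"] continuous_intros
        simp: c_def split: if_splits)
  have c: "c \<ge> 2" "c \<le> real m + 3" by (auto simp: c_def)
  have eq: "linear_sieve_sol (Suc m) =
      (\<lambda>s. (integral {c..real m + 3} u - integral {c..max s c} u) / s)"
    using step.hyps by (auto simp: fun_eq_iff c_def u_def Let_def)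
  show ?case
    using linear_sieve_sol_step(3,4)[OF u(1) c u(2)] unfolding eq by (auto simp: add_ac)
qed

lemma linear_sieve_system_sol: "linear_sieve_system linear_sieve_sol"
proof -
  have deriv:
    "(s \<ge> c \<longrightarrow> ((\<lambda>t. t * linear_sieve_sol n t) has_real_derivative
        - linear_sieve_sol (n - 1) (s - 1)) (at s within {c..})) \<and>
     (1 \<le> s \<and> s \<le> c \<longrightarrow> ((\<lambda>t. t * linear_sieve_sol n t) has_real_derivative 0)
        (at s within {1..c}))"
    if n: "n \<ge> 2" and c_def: "c = (if even n then 2 else 3)" for n s and c :: real
  proof -
    obtain m where m: "n = Suc m" "m \<ge> 1" using n by (cases n) auto
    define u where "u = (\<lambda>t. linear_sieve_sol m (t - 1))"
    have u: "continuous_on {c..} u" "\<And>t. t \<ge> real m + 3 \<Longrightarrow> u t = 0"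
      unfolding u_def using linear_sieve_sol_aux[OF m(2)]
      by (auto intro!: continuous_on_compose2[of "{1..}" "linear_sieve_sol m"] continuous_intros
          simp: c_def split: if_splits)
    have c: "c \<ge> 2" "c \<le> real m + 3" by (auto simp: c_def)
    have eq: "linear_sieve_sol n =
        (\<lambda>s. (integral {c..real m + 3} u - integral {c..max s c} u) / s)"
      using m by (auto simp: fun_eq_iff c_def u_def Let_def)
    show ?thesis
      using linear_sieve_sol_step(1,2)[OF u(1) c u(2), of s] unfolding eq
      by (simp add: m u_def)
  qed
  show ?thesis
    unfolding linear_sieve_system_def
  proof (intro conjI allI impI)
    show "linear_sieve_sol n s = 0" if "n \<ge> 1" "s \<ge> real n + 2" for n s
      using linear_sieve_sol_aux that by blast
  next
    show "s * linear_sieve_sol 1 s = 3 - s" if "1 \<le> s \<and> s \<le> 3" for s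
      using that by simp
  qed (use deriv[of _ 2] deriv[of _ 3] in auto)
qed

end

theory Submission
  imports Defs
begin

text \<open>
  The upper and lower linear sieves satisfy mutual recursions on the largest prime factor. Together
  with the density hypothesis in the form \<open>V(u) \<le> (1 + \<epsilon>) (log z / log u) V(z)\<close>, partial summation
  turns these into the integral recursions for the partial sums of \<open>F - 1\<close> and \<open>1 - f\<close>, up to an error
  of order \<open>\<epsilon>\<close>. The error is carried through the induction as one multiple of \<open>\<epsilon> e\<^sup>2 h(s)\<close> for all
  partial sums at once. Two rounds of the recursion shrink it by the factor 0.92, so the constant is
  governed by what each round adds, essentially \<open>F(s - 1) - f(s)\<close>, and good bounds for
  \<open>F\<close> and \<open>f\<close> are needed. These come from the conserved quantity of the delay equation for \<open>F - f\<close>,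
  which gives \<open>f(2) \<ge> 0\<close>, whence \<open>F(1) \<le> 4 / log 3\<close>. Primes in \<open>Q\<close> are removed by
  full inclusion-exclusion.
\<close>

subsection \<open>The comparison function\<close>

text \<open>All analysis concerns finite partial sums. Each level of the recursion adds one more
  function, and the partial sums satisfy the delay equations exactly, so no infinite series is ever
  differentiated; since all \<open>f n\<close> are nonnegative, the series replace their partial
  sums only in the final inequalities. Integrals of monotone functions appear in difference form:
  \<open>\<phi> (y - 1) * (y - x) \<le> \<Psi> x - \<Psi> y\<close> states that
  \<open>\<Psi>\<close> falls at least as fast as the integral of \<open>\<phi> (t - 1)\<close>.
  Such inequalities add up across the break points of h and are just what summation by parts
  consumes. The obstacle is that a single round hardly contracts. For epsilon near 1/200, the
  passage from the upper to the lower bound has factor about 0.97, extremal at s = 2; the passage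
  back, made at s = 3 and then carried to s = 1, has about 0.95. These are the two factors of a
  double round, and they are so close to 1 that crude bounds for the added terms would be magnified
  too much. The induction yields 161 on both sides; the gap to the stated 164 and 162 gives
  strictness.\<close>

definition hnorm :: "real \<Rightarrow> real" where
  "hnorm s = exp 2 * sieve_h s"

lemma hnorm_le2: "s \<le> 2 \<Longrightarrow> hnorm s = 1"
  by (simp add: hnorm_def sieve_h_def exp_minus)

lemma hnorm_23: "2 \<le> s \<Longrightarrow> s \<le> 3 \<Longrightarrow> hnorm s = exp (2 - s)"
  by (cases "s = 2") (simp_all add: hnorm_def sieve_h_def exp_minus exp_diff field_simps)

lemma hnorm_ge3: "3 \<le> s \<Longrightarrow> hnorm s = 3 * exp (2 - s) / s"
  by (cases "s = 3") (simp_all add: hnorm_def sieve_h_def field_simps flip: exp_add)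

lemma hnorm_pos: "1 \<le> s \<Longrightarrow> hnorm s > 0"
  by (simp add: hnorm_def sieve_h_def)

lemma hnorm_antimono:
  assumes "1 \<le> x" "x \<le> y"
  shows "hnorm y \<le> hnorm x"
proof -
  have A: "hnorm y \<le> hnorm x" if "3 \<le> x" "x \<le> y" for x y
    using that unfolding hnorm_ge3[OF that(1)] hnorm_ge3[OF order_trans[OF that]]
    by (intro frac_le) auto
  have B: "hnorm y \<le> hnorm x" if "1 \<le> x" "x \<le> y" "y \<le> 3" for x y
    using that by (cases "x \<le> 2"; cases "y \<le> 2") (auto simp: hnorm_le2 hnorm_23)
  show ?thesis
  proof (cases "3 \<le> x \<or> y \<le> 3")
    case True then show ?thesis using A B assms by auto
  next
    case False
    then have "hnorm y \<le> hnorm 3" "hnorm 3 \<le> hnorm x" using A[of 3 y] B[of x 3] assms by auto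
    then show ?thesis by simp
  qed
qed

section \<open>Elementary numerical bounds for exp and ln\<close>

lemma exp_ge_Taylor:
  fixes x :: real
  assumes "even n"
  shows "(\<Sum>m<n. x ^ m / fact m) \<le> exp x"
proof -
  obtain t where "exp x = (\<Sum>m<n. x ^ m / fact m) + exp t / fact n * x ^ n"
    using Maclaurin_exp_le by blast
  \<comment> \<open>For even \<open>n\<close> the Lagrange remainder is nonnegative whatever the
    sign of \<open>x\<close>.\<close>
  then show ?thesis using assms by (simp add: zero_le_even_power)
qed

lemma exp_minus_ge_cubic: "exp (- x) \<ge> 1 - x + x\<^sup>2 / 2 - x ^ 3 / (6::real)"
  proof -
  have "(\<Sum>m<4. (- x) ^ m / fact m) \<le> exp (- x)" by (rule exp_ge_Taylor) simp
  then show ?thesis by (simp add: eval_nat_numeral)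
qed

text \<open>Six terms of the series. This precision is spent in \<open>small_step\<close>, where
  \<open>hnorm 3 = exp (-1)\<close> is multiplied by more than 400.\<close>

lemma exp_1_gt: "exp (1::real) > 27166 / 10000"
  proof -
  have "(\<Sum>m<6. (1::real) ^ m / fact m) \<le> exp 1" by (rule exp_ge_Taylor) simp
  then show ?thesis by (simp add: eval_nat_numeral)
qed

text \<open>The value 2/15 satisfies 5/2 * 3 * (2/15) = 1, the balance required at s = 4 in
  \<open>sums_le_hnorm\<close>.\<close>

lemma exp_minus_2_ge: "exp (-2::real) \<ge> 2 / 15"
proof -
  have "exp (2::real) = exp 1 * exp 1" by (simp flip: exp_add)
  also have "\<dots> \<le> 272 / 100 * (272 / 100)"
    using e_less_272 by (intro mult_mono) auto
  finally have "exp (2::real) \<le> 15 / 2" by simp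
  then have "inverse (exp 2) \<ge> inverse (15 / 2 :: real)" by (intro le_imp_inverse_le) auto
  then show ?thesis by (simp add: exp_minus)
qed

lemma ln_3_ge: "ln (3::real) \<ge> 400 / 365"
  using ln_approx_bounds[of 3 4] by (simp add: eval_nat_numeral)

text \<open>An upper bound for \<open>\<integral> hnorm (t - 1) dt\<close> over \<open>[s, \<infinity>)\<close>: the exact integral, except that
  \<open>E\<^sub>1(x) = \<integral> e\<^bsup>-t\<^esup> / t dt\<close> over \<open>[x, \<infinity>)\<close> is replaced by \<open>e\<^bsup>-x\<^esup> (x + 1) / (x (x + 2))\<close>. The simpler bound
  \<open>e\<^bsup>-x\<^esup> / x\<close> would be too weak at \<open>s = 2\<close>.\<close>

definition hnorm_tail :: "real \<Rightarrow> real" where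
  "hnorm_tail s = (if s \<le> 3 then 4 - s - exp (-1) / 5
    else if s \<le> 4 then exp (3 - s) - exp (-1) / 5
    else 3 * exp (3 - s) * s / (s\<^sup>2 - 1))"

text \<open>The constant \<open>exp (-1) / 5\<close> makes the branches meet at s = 4, where the
  last one equals \<open>4 / 5 * exp (-1)\<close>. The first two branches meet at s = 3.\<close>

lemma hnorm_tail_34: "3 \<le> s \<Longrightarrow> s \<le> 4 \<Longrightarrow> hnorm_tail s = exp (3 - s) - exp (-1) / 5"
  by (cases "s = 3") (simp_all add: hnorm_tail_def)

lemma hnorm_tail_ge4: "4 \<le> s \<Longrightarrow> hnorm_tail s = 3 * exp (3 - s) * s / (s\<^sup>2 - 1)"
  by (cases "s = 4") (simp_all add: hnorm_tail_def)

lemma hnorm_tail_nonneg: "2 \<le> s \<Longrightarrow> hnorm_tail s \<ge> 0"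
proof -
  assume s: "2 \<le> s"
  consider "s \<le> 3" | "3 \<le> s" "s \<le> 4" | "4 \<le> s" by linarith
  then show ?thesis
  proof cases
    case 1
    have "exp (-1::real) \<le> 1" by simp
    then have "4 - s - exp (-1) / 5 \<ge> 0" using 1 by linarith
    then show ?thesis using 1 by (simp add: hnorm_tail_def)
  next
    case 2
    have "exp (-1) \<le> exp (3 - s)" using 2 by simp
    moreover have "exp (-1::real) > 0" by simp
    ultimately have "exp (-1) / 5 \<le> exp (3 - s)" by linarith
    then show ?thesis using 2 by (simp add: hnorm_tail_34)
  next
    case 3
    have "s\<^sup>2 \<ge> 1" using 3 by (simp add: one_le_power)
    then show ?thesis using 3 by (simp add: hnorm_tail_ge4)
  qed
qed

text \<open>As \<open>hnorm\<close> decreases, the left side is at most the integral of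
  \<open>hnorm (t - 1)\<close> over [x, y]. The inequality may be proved on adjacent intervals and
  added (\<open>split\<close>), so the break points 3 and 4 cause no trouble;
  \<open>1 + d \<le> exp d\<close> handles the exponential pieces.\<close>

lemma hnorm_tail_drop:
  assumes "2 \<le> x" "x \<le> y"
  shows "hnorm (y - 1) * (y - x) \<le> hnorm_tail x - hnorm_tail y"
proof -
  have split: "hnorm (y - 1) * (y - x) \<le> hnorm_tail x - hnorm_tail y"
    if "2 \<le> x" "x \<le> m" "m \<le> y" "hnorm (m - 1) * (m - x) \<le> hnorm_tail x - hnorm_tail m"
      "hnorm (y - 1) * (y - m) \<le> hnorm_tail m - hnorm_tail y" for x y m
  proof -
    have "hnorm (y - 1) * (m - x) \<le> hnorm (m - 1) * (m - x)"
      using that by (intro mult_right_mono hnorm_antimono) auto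
    then show ?thesis using that by (simp add: algebra_simps)
  qed
  have a: "hnorm (y - 1) * (y - x) \<le> hnorm_tail x - hnorm_tail y" if "2 \<le> x" "x \<le> y" "y \<le> 3" for x y
    using that by (simp add: hnorm_tail_def hnorm_le2)
  have b: "hnorm (y - 1) * (y - x) \<le> hnorm_tail x - hnorm_tail y" if "3 \<le> x" "x \<le> y" "y \<le> 4" for x y
  proof -
    have "exp (3 - y) * (1 + (y - x)) \<le> exp (3 - y) * exp (y - x)"
      by (intro mult_left_mono exp_ge_add_one_self) auto
    moreover have "exp (3 - y) * exp (y - x) = exp (3 - x)" by (simp flip: exp_add)
    moreover have "hnorm (y - 1) = exp (3 - y)" using that by (simp add: hnorm_23)
    ultimately show ?thesis using that by (simp add: hnorm_tail_34 distrib_left)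
  qed
  have c: "hnorm (y - 1) * (y - x) \<le> hnorm_tail x - hnorm_tail y" if "4 \<le> x" "x \<le> y" for x y
  proof -
    define d where "d = y - x"
    have y: "y = x + d" and d: "d \<ge> 0" using that by (auto simp: d_def)
    have x1: "x\<^sup>2 - 1 > 0" "y\<^sup>2 - 1 > 0"
      using that by (simp_all add: one_less_power)
    have 1: "3 * exp (3 - y) * (1 + d) \<le> 3 * exp (3 - x)"
    proof -
      have "exp (3 - y) * (1 + d) \<le> exp (3 - y) * exp d"
        by (intro mult_left_mono exp_ge_add_one_self) auto
      then show ?thesis by (simp add: y flip: exp_add)
    qed
    \<comment> \<open>This is the rational inequality \<open>2\<close> below with its denominators
      cleared; it remains once \<open>1 + d \<le> exp d\<close> has removed the
      exponentials.\<close>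
    have "(1 + d) * x * (y\<^sup>2 - 1) - (d * (y + 1) + y) * (x\<^sup>2 - 1)
       = d * (x * y * d + x * d + d + 2)"
      by (simp add: y algebra_simps power2_eq_square)
    also have "\<dots> \<ge> 0" using that d by simp
    finally have 2: "(d * (y + 1) + y) / (y\<^sup>2 - 1) \<le> (1 + d) * (x / (x\<^sup>2 - 1))"
      using x1 by (simp add: divide_le_eq pos_divide_le_eq pos_le_divide_eq mult.assoc)
    have 3: "(d * (y + 1) + y) / (y\<^sup>2 - 1) = d / (y - 1) + y / (y\<^sup>2 - 1)"
    proof -
      have "y\<^sup>2 - 1 = (y - 1) * (y + 1)" by (simp add: algebra_simps power2_eq_square)
      then show ?thesis using that by (simp add: add_divide_distrib)
    qed
    have "3 * exp (3 - y) * (d / (y - 1) + y / (y\<^sup>2 - 1)) \<le> 3 * exp (3 - y) * ((1 + d) * (x / (x\<^sup>2 - 1)))"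
      using 2 3 by (intro mult_left_mono) auto
    also have "\<dots> = (3 * exp (3 - y) * (1 + d)) * (x / (x\<^sup>2 - 1))" by simp
    also have "\<dots> \<le> 3 * exp (3 - x) * (x / (x\<^sup>2 - 1))"
      using 1 x1 that by (intro mult_right_mono) auto
    finally have "3 * exp (3 - y) / (y - 1) * d \<le> 3 * exp (3 - x) * x / (x\<^sup>2 - 1) - 3 * exp (3 - y) * y / (y\<^sup>2 - 1)"
      by (simp add: distrib_left mult.assoc)
    moreover have "hnorm (y - 1) = 3 * exp (3 - y) / (y - 1)" using that by (simp add: hnorm_ge3)
    ultimately show ?thesis using that by (simp add: hnorm_tail_ge4 d_def)
  qed
  have b': "hnorm (y - 1) * (y - x) \<le> hnorm_tail x - hnorm_tail y" if "3 \<le> x" "x \<le> y" for x y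
  proof -
    consider "y \<le> 4" | "4 \<le> x" | "x \<le> 4" "4 \<le> y" by linarith
    then show ?thesis
      by cases (use split[of x 4 y] b[of x 4] c[of 4 y] b[of x y] c[of x y] that in auto)
  qed
  consider "y \<le> 3" | "3 \<le> x" | "x \<le> 3" "3 \<le> y" by linarith
  then show ?thesis
    by cases (use split[of x 3 y] a[of x 3] b'[of 3 y] a[of x y] b'[of x y] assms in auto)
qed

text \<open>The ratio is largest at s = 4, where it equals \<open>4 * exp 1 / 3\<close>, about
  3.62.\<close>

lemma hnorm_shift:
  assumes "2 \<le> s"
  shows "hnorm (s - 1) \<le> 4 * hnorm s"
proof -
  have e: "exp (1::real) < (272/100)" by (rule e_less_272)
  consider "s \<le> 3" | "3 \<le> s" "s \<le> 4" | "4 \<le> s" by linarith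
  then show ?thesis
  proof cases
    case 1
    have "exp (2 - s) * exp (s - 2) = 1" by (simp flip: exp_add)
    moreover have "exp (s - 2) \<le> exp 1" using 1 by simp
    ultimately have "1 \<le> exp (2 - s) * exp 1" 
      by (metis exp_ge_zero mult_left_mono)
    also have "\<dots> \<le> exp (2 - s) * 4" using e by (intro mult_left_mono) auto
    finally show ?thesis using 1 assms by (simp add: hnorm_le2 hnorm_23)
  next
    case 2
    have "hnorm (s - 1) = exp (2 - s) * exp 1"
      using 2 by (simp add: hnorm_23 flip: exp_add)
    also have "\<dots> \<le> exp (2 - s) * (12 / s)"
    proof (intro mult_left_mono)
      have "exp 1 * s \<le> (272/100) * 4" using e 2 by (intro mult_mono) auto
      then show "exp 1 \<le> 12 / s" using 2 by (simp add: pos_le_divide_eq)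
    qed simp
    finally show ?thesis using 2 by (simp add: hnorm_ge3 mult.commute)
  next
    case 3
    have "hnorm (s - 1) = 3 * exp (2 - s) * (exp 1 / (s - 1))"
    proof -
      have "exp (3 - s) = exp (2 - s) * exp 1" by (simp flip: exp_add)
      then show ?thesis using 3 by (simp add: hnorm_ge3)
    qed
    also have "\<dots> \<le> 3 * exp (2 - s) * (4 / s)"
    proof (intro mult_left_mono)
      have "exp 1 * s \<le> 272/100 * s" using e 3 by (intro mult_right_mono) auto
      also have "\<dots> \<le> 4 * (s - 1)" using 3 by simp
      finally show "exp 1 / (s - 1) \<le> 4 / s" using 3 by (simp add: frac_le_eq pos_divide_le_eq pos_le_divide_eq)
    qed simp
    finally show ?thesis using 3 by (simp add: hnorm_ge3)
  qed
qed

lemma hnorm_tail_ge4_le: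
  assumes "4 \<le> s"
  shows "hnorm_tail s \<le> 4 / 15 * exp 1 * (s * hnorm s)"
proof -
  have p: "s\<^sup>2 - 1 > 0" using assms by (simp add: one_less_power)
  have "s / (s\<^sup>2 - 1) \<le> 4 / 15"
  proof -
    have "15 * s \<le> 4 * (s\<^sup>2 - 1)"
      using mult_nonneg_nonneg[of "s - 4" "4 * s + 1"] assms
      by (simp add: algebra_simps power2_eq_square)
    then show ?thesis using p by (simp add: pos_divide_le_eq)
  qed
  then have "3 * exp (3 - s) * (s / (s\<^sup>2 - 1)) \<le> 3 * exp (3 - s) * (4 / 15)"
    by (intro mult_left_mono) auto
  moreover have "exp (3 - s) = exp 1 * exp (2 - s)" by (simp flip: exp_add)
  ultimately show ?thesis using assms by (simp add: hnorm_tail_ge4 hnorm_ge3)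
qed

text \<open>On [3, 4] the quotient is \<open>exp 1 / 3 - exp (s - 3) / 15\<close>, largest at s = 3
  with value 0.8394; beyond 4 it is below 0.73.\<close>

lemma hnorm_tail_ge3_le:
  assumes "3 \<le> s"
  shows "hnorm_tail s \<le> (84/100) * (s * hnorm s)"
proof (cases "s \<le> 4")
  case True
  have "exp 1 * exp (2 - s) = exp (3 - s)" by (simp flip: exp_add)
  moreover have "exp (2 - s) \<le> exp (-1)" using assms by simp
  moreover have "exp (2 - s) * exp 1 \<le> exp (2 - s) * (272/100)" using e_less_272
    by (intro mult_left_mono) auto
  ultimately have "exp (3 - s) - exp (-1) / 5 \<le> 84 / 100 * (3 * exp (2 - s))" by argo
  then show ?thesis using True assms by (simp add: hnorm_tail_34 hnorm_ge3)
next
  case False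
  have "s * hnorm s \<ge> 0" using hnorm_pos[of s] assms by simp
  then have "4 / 15 * exp 1 * (s * hnorm s) \<le> (84/100) * (s * hnorm s)"
    using e_less_272 by (intro mult_right_mono) auto
  with hnorm_tail_ge4_le[of s] False show ?thesis by linarith
qed

text \<open>With the cubic Taylor polynomial in place of the exponential, the product is exactly 1
  at s = 3, which explains the factor \<open>1 - x\<close> in the proof.\<close>

lemma one_le_mult_exp:
  fixes s :: real
  assumes "2 \<le> s" "s \<le> 3"
  shows "1 \<le> s * exp (2 - s)"
proof -
  define x where "x = s - 2"
  have x: "0 \<le> x" "x \<le> 1" using assms by (auto simp: x_def)
  have "1 \<le> (2 + x) * (1 - x + x\<^sup>2 / 2 - x ^ 3 / 6)"
  proof -
    have "(2 + x) * (1 - x + x\<^sup>2 / 2 - x ^ 3 / 6) - 1 = (1 - x) * (1 + x ^ 3 / 6)"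
      by (simp add: field_simps power2_eq_square power3_eq_cube)
    also have "\<dots> \<ge> 0" using x by simp
    finally show ?thesis by simp
  qed
  also have "\<dots> \<le> (2 + x) * exp (- x)"
    using x by (intro mult_left_mono exp_minus_ge_cubic) auto
  finally show ?thesis by (simp add: x_def)
qed

subsection \<open>Partial sums of the sieve functions\<close>

lemma mvt_halfline:
  fixes F D :: "real \<Rightarrow> real"
  assumes "\<And>s. c \<le> s \<Longrightarrow> (F has_real_derivative D s) (at s within {c..})"
    and "c \<le> x" "x \<le> y"
  obtains \<xi> where "x \<le> \<xi>" "\<xi> \<le> y" "F y - F x = D \<xi> * (y - x)"
proof (cases "x = y")
  case True then show ?thesis using that[of x] by simp
next
  case False
  have "\<exists>\<xi>\<in>{x<..<y}. F y - F x = D \<xi> * (y - x)"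
  proof (rule mvt_simple)
    show "x < y" using False assms by simp
    fix s assume "x \<le> s" "s \<le> y"
    then have "(F has_real_derivative D s) (at s within {x..y})"
      using assms by (intro has_field_derivative_subset[OF assms(1)]) auto
    then show "(F has_derivative (*) (D s)) (at s within {x..y})"
      by (simp add: has_field_derivative_def)
  qed
  then obtain \<xi> where "x < \<xi>" "\<xi> < y" "F y - F x = D \<xi> * (y - x)" by auto
  then show ?thesis using that[of \<xi>] by simp
qed

lemma constant_of_deriv_zero:
  fixes F :: "real \<Rightarrow> real"
  assumes "\<And>s. s \<in> {a..b} \<Longrightarrow> (F has_real_derivative 0) (at s within {a..b})"
    and "x \<in> {a..b}" "y \<in> {a..b}"
  shows "F x = F y"
  using has_field_derivative_zero_constant[of "{a..b}" F] assms by (metis convex_real_interval(5))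

text \<open>On n equal subintervals the drop of \<open>F\<close> is bounded by left-end values of
  \<open>u\<close> and that of \<open>J\<close> from below by right-end values. The discrepancies
  telescope to \<open>(u a - u b) * (b - a) / n\<close>, and n is arbitrary. It transfers bounds
  through the delay equation, with \<open>J\<close> a multiple of \<open>hnorm_tail\<close>.\<close>

lemma drop_compare:
  fixes F J u :: "real \<Rightarrow> real"
  assumes F: "\<And>x y. a \<le> x \<Longrightarrow> x \<le> y \<Longrightarrow> y \<le> b \<Longrightarrow> F x - F y \<le> u x * (y - x)"
    and J: "\<And>x y. a \<le> x \<Longrightarrow> x \<le> y \<Longrightarrow> y \<le> b \<Longrightarrow> u y * (y - x) \<le> J x - J y"
    and "a \<le> b"
  shows "F a - F b \<le> J a - J b"
proof -
  let ?G = "\<lambda>x. F x - J x"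
  have bound: "real n * (?G a - ?G b) \<le> (u a - u b) * (b - a)" if "n > 0" for n
  proof -
    define d where "d = (b - a) / real n"
    define x where "x = (\<lambda>i. a + real i * d)"
    have d: "d \<ge> 0" "real n * d = b - a" using \<open>a \<le> b\<close> that by (simp_all add: d_def)
    have x: "a \<le> x i" "x i \<le> x (Suc i)" "x (Suc i) - x i = d" for i
      using d by (auto simp: x_def distrib_right)
    have xb: "x i \<le> b" if "i \<le> n" for i
    proof -
      have "real i * d \<le> real n * d" using that d by (intro mult_right_mono) auto
      then show ?thesis using d by (simp add: x_def)
    qed
    have "?G (x 0) - ?G (x i) \<le> (u (x 0) - u (x i)) * d" if "i \<le> n" for i
      using that
    proof (induction i)
      case (Suc i)
      have "?G (x i) - ?G (x (Suc i)) \<le> (u (x i) - u (x (Suc i))) * d"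
        using F[of "x i" "x (Suc i)"] J[of "x i" "x (Suc i)"] x[of i] xb[OF Suc.prems]
        by (simp add: left_diff_distrib)
      then show ?case using Suc by (simp add: left_diff_distrib)
    qed simp
    from this[of n] have "?G a - ?G b \<le> (u a - u b) * d"
      using d by (simp add: x_def)
    then have "real n * (?G a - ?G b) \<le> real n * ((u a - u b) * d)"
      by (intro mult_left_mono) auto
    also have "\<dots> = (u a - u b) * (b - a)" unfolding d(2)[symmetric] by simp
    finally show ?thesis .
  qed
  show ?thesis
  proof (rule ccontr)
    assume "\<not> ?thesis"
    then have "?G a - ?G b > 0" by simp
    from reals_Archimedean3[OF this] obtain n where
      n: "(u a - u b) * (b - a) < real n * (?G a - ?G b)" by blast
    moreover have "0 \<le> (u a - u b) * (b - a)"
      using bound[of 1] \<open>?G a - ?G b > 0\<close> by simp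
    ultimately show False using bound[of n] by (cases "n = 0") auto
  qed
qed

section \<open>The sieve functions: sign, monotonicity and partial sums\<close>

locale linear_sieve =
  fixes f :: "nat \<Rightarrow> real \<Rightarrow> real"
  assumes system: "linear_sieve_system f"
begin

lemma system_vanish: "1 \<le> n \<Longrightarrow> real n + 2 \<le> s \<Longrightarrow> f n s = 0"
  using system unfolding linear_sieve_system_def by blast

lemma system_first: "1 \<le> s \<Longrightarrow> s \<le> 3 \<Longrightarrow> s * f 1 s = 3 - s"
  using system unfolding linear_sieve_system_def by blast

lemma even_deriv:
  assumes "2 \<le> s"
  shows "((\<lambda>t. t * f (2 * j + 2) t) has_real_derivative - f (2 * j + 1) (s - 1)) (at s within {2..})"
proof -
  have "\<forall>n\<ge>2. even n \<longrightarrow> (\<forall>s\<ge>2.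
      ((\<lambda>t. t * f n t) has_real_derivative - f (n - 1) (s - 1)) (at s within {2..}))"
    using system unfolding linear_sieve_system_def by blast
  from this[rule_format, of "2 * j + 2" s] show ?thesis using assms by simp
qed

lemma odd_deriv:
  assumes "3 \<le> s"
  shows "((\<lambda>t. t * f (2 * j + 3) t) has_real_derivative - f (2 * j + 2) (s - 1)) (at s within {3..})"
proof -
  have "\<forall>n\<ge>2. odd n \<longrightarrow> (\<forall>s\<ge>3.
      ((\<lambda>t. t * f n t) has_real_derivative - f (n - 1) (s - 1)) (at s within {3..}))"
    using system unfolding linear_sieve_system_def by blast
  moreover have "odd (2 * j + 3)" "2 * j + 3 - 1 = 2 * j + 2" by simp_all
  ultimately show ?thesis using assms by (elim allE[of _ "2 * j + 3"]) simp
qed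

lemma odd_const:
  assumes "1 \<le> s" "s \<le> 3"
  shows "s * f (2 * j + 3) s = 3 * f (2 * j + 3) 3"
proof -
  have *: "\<forall>n\<ge>2. odd n \<longrightarrow> (\<forall>s. 1 \<le> s \<and> s \<le> 3 \<longrightarrow>
      ((\<lambda>t. t * f n t) has_real_derivative 0) (at s within {1..3}))"
    using system unfolding linear_sieve_system_def by blast
  have "((\<lambda>t. t * f (2 * j + 3) t) has_real_derivative 0) (at s within {1..3})"
    if "s \<in> {1..3}" for s
    using *[rule_format, of "2 * j + 3" s] that by simp
  from constant_of_deriv_zero[OF this, of s 3] show ?thesis using assms by simp
qed

text \<open>\<open>s * f n s\<close> is nonincreasing and vanishes from \<open>real n + 2\<close>
  on.\<close>

lemma nonneg_step:
  assumes deriv: "\<And>s. c \<le> s \<Longrightarrow>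
      ((\<lambda>t. t * f n t) has_real_derivative - u s) (at s within {c..})"
    and u: "\<And>s. c \<le> s \<Longrightarrow> u s \<ge> 0" and "c \<ge> 1" "n \<ge> 1" "c \<le> s"
  shows "f n s \<ge> 0"
proof -
  define y where "y = max s (real n + 2)"
  obtain \<xi> where "s \<le> \<xi>" "y * f n y - s * f n s = - u \<xi> * (y - s)"
    using mvt_halfline[OF deriv, of s y] assms(5) by (auto simp: y_def)
  moreover have "f n y = 0" using system_vanish assms by (simp add: y_def)
  moreover have "u \<xi> * (y - s) \<ge> 0"
    using u[of \<xi>] assms \<open>s \<le> \<xi>\<close> by (simp add: y_def)
  ultimately have "s * f n s \<ge> 0" by simp
  then show ?thesis using assms by (simp add: zero_le_mult_iff)
qed

lemma f_nonneg:
  "(\<forall>s\<ge>1. f (2 * j + 1) s \<ge> 0) \<and> (\<forall>s\<ge>2. f (2 * j + 2) s \<ge> 0)"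
proof -
  have ev: "\<forall>s\<ge>2. f (2 * j + 2) s \<ge> 0" if "\<forall>s\<ge>1. f (2 * j + 1) s \<ge> 0" for j
    using that
    by (intro allI impI nonneg_step[of 2 "2 * j + 2" "\<lambda>s. f (2 * j + 1) (s - 1)"] even_deriv) auto
  show ?thesis
  proof (induction j)
    case 0
    have "f 1 s \<ge> 0" if "s \<ge> 1" for s
    proof (cases "s \<le> 3")
      case True
      then have "s * f 1 s \<ge> 0" using system_first that by simp
      then show ?thesis using that by (simp add: zero_le_mult_iff)
    next
      case False then show ?thesis using system_vanish[of 1 s] by simp
    qed
    then show ?case using ev[of 0] by simp
  next
    case (Suc j)
    have 3: "f (2 * j + 3) s \<ge> 0" if "s \<ge> 3" for s
      using Suc that
      by (intro nonneg_step[of 3 "2 * j + 3" "\<lambda>s. f (2 * j + 2) (s - 1)"] odd_deriv) auto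
    have "f (2 * j + 3) s \<ge> 0" if "s \<ge> 1" for s
    proof (cases "s \<le> 3")
      case True
      then have "s * f (2 * j + 3) s \<ge> 0" using odd_const[of s j] 3[of 3] that by simp
      then show ?thesis using that by (simp add: zero_le_mult_iff)
    qed (use 3 in auto)
    then show ?case using ev[of "Suc j"] by (simp add: eval_nat_numeral)
  qed
qed

definition odd_sum :: "nat \<Rightarrow> real \<Rightarrow> real" where
  "odd_sum k s = (\<Sum>j<k. f (2 * j + 1) s)"

definition even_sum :: "nat \<Rightarrow> real \<Rightarrow> real" where
  "even_sum k s = (\<Sum>j<k. f (2 * j + 2) s)"

lemma odd_sum_nonneg: "1 \<le> s \<Longrightarrow> odd_sum k s \<ge> 0"
  unfolding odd_sum_def using f_nonneg by (intro sum_nonneg) auto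

lemma even_sum_nonneg: "2 \<le> s \<Longrightarrow> even_sum k s \<ge> 0"
  unfolding even_sum_def using f_nonneg by (intro sum_nonneg) auto

lemma odd_sum_vanish: "2 * real k + 1 \<le> s \<Longrightarrow> odd_sum k s = 0"
  unfolding odd_sum_def by (intro sum.neutral ballI system_vanish) auto

lemma even_sum_vanish: "2 * real k + 2 \<le> s \<Longrightarrow> even_sum k s = 0"
  unfolding even_sum_def by (intro sum.neutral ballI system_vanish) auto

lemma even_sum_deriv: "2 \<le> s \<Longrightarrow>
    ((\<lambda>t. t * even_sum k t) has_real_derivative - odd_sum k (s - 1)) (at s within {2..})"
  unfolding odd_sum_def even_sum_def sum_distrib_left sum_negf[symmetric] by (intro DERIV_sum even_deriv)

lemma odd_sum_Suc: "odd_sum (Suc k) s = f 1 s + (\<Sum>j<k. f (2 * j + 3) s)"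
  unfolding odd_sum_def by (subst sum.lessThan_Suc_shift) (simp add: eval_nat_numeral)

text \<open>The index falls from \<open>Suc k\<close> to \<open>k\<close> because \<open>f 1\<close>
  vanishes from 3 on and every other odd function is driven by its even predecessor. In
  \<open>even_sum_deriv\<close> the index stays; this asymmetry spoils exact conservation in
  \<open>even_sum_2_le\<close>.\<close>

lemma odd_sum_deriv:
  assumes "3 \<le> s"
  shows "((\<lambda>t. t * odd_sum (Suc k) t) has_real_derivative - even_sum k (s - 1)) (at s within {3..})"
proof -
  have 1: "((\<lambda>t. \<Sum>j<k. t * f (2 * j + 3) t) has_real_derivative - even_sum k (s - 1)) (at s within {3..})"
    unfolding even_sum_def sum_negf[symmetric] using assms by (intro DERIV_sum odd_deriv)
  have 2: "(\<Sum>j<k. t * f (2 * j + 3) t) = t * odd_sum (Suc k) t" if "t \<ge> 3" for t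
    using system_vanish[of 1 t] that by (simp add: odd_sum_Suc sum_distrib_left)
  show ?thesis
    by (rule has_field_derivative_transform_within[OF 1, where d = 1]) (use assms 2 in auto)
qed

text \<open>For positive \<open>k\<close> this is the constant value of
  \<open>s * (1 + odd_sum k s)\<close> on [1, 3], the truncated form of s F(s).\<close>

definition cst :: "nat \<Rightarrow> real" where
  "cst k = 3 + 3 * odd_sum k 3"

lemma odd_sum_explicit:
  assumes "1 \<le> s" "s \<le> 3"
  shows "s * odd_sum (Suc k) s = cst (Suc k) - s"
proof -
  have "s * odd_sum (Suc k) s = 3 - s + (\<Sum>j<k. s * f (2 * j + 3) s)"
    using system_first[OF assms] by (simp add: odd_sum_Suc distrib_left sum_distrib_left)
  also have "(\<Sum>j<k. s * f (2 * j + 3) s) = (\<Sum>j<k. 3 * f (2 * j + 3) 3)"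
    using odd_const[OF assms] by simp
  also have "\<dots> = 3 * odd_sum (Suc k) 3"
    using system_first[of 3] by (simp add: odd_sum_Suc sum_distrib_left)
  finally show ?thesis by (simp add: cst_def)
qed

lemma cst_ge: "cst k \<ge> 3"
  using odd_sum_nonneg[of 3 k] by (simp add: cst_def)

lemma even_sum_mvt:
  assumes "2 \<le> x" "x \<le> y"
  obtains \<xi> where "x \<le> \<xi>" "\<xi> \<le> y" "x * even_sum k x - y * even_sum k y = odd_sum k (\<xi> - 1) * (y - x)"
proof (rule mvt_halfline[OF even_sum_deriv, of x y k])
  fix \<xi> assume "x \<le> \<xi>" "\<xi> \<le> y" "y * even_sum k y - x * even_sum k x = - odd_sum k (\<xi> - 1) * (y - x)"
  then show ?thesis using that[of \<xi>] by simp
qed (use assms in auto)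

lemma odd_sum_mvt:
  assumes "3 \<le> x" "x \<le> y"
  obtains \<xi> where "x \<le> \<xi>" "\<xi> \<le> y"
    "x * odd_sum (Suc k) x - y * odd_sum (Suc k) y = even_sum k (\<xi> - 1) * (y - x)"
proof (rule mvt_halfline[OF odd_sum_deriv, of x y k])
  fix \<xi> assume "x \<le> \<xi>" "\<xi> \<le> y" "y * odd_sum (Suc k) y - x * odd_sum (Suc k) x = - even_sum k (\<xi> - 1) * (y - x)"
  then show ?thesis using that[of \<xi>] by simp
qed (use assms in auto)

lemma mult_even_sum_antimono:
  assumes "2 \<le> x" "x \<le> y"
  shows "y * even_sum k y \<le> x * even_sum k x"
proof -
  obtain \<xi> where "x \<le> \<xi>" "x * even_sum k x - y * even_sum k y = odd_sum k (\<xi> - 1) * (y - x)"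
    using even_sum_mvt[OF assms] .
  moreover have "odd_sum k (\<xi> - 1) * (y - x) \<ge> 0"
    using odd_sum_nonneg[of "\<xi> - 1" k] \<open>x \<le> \<xi>\<close> assms by simp
  ultimately show ?thesis by simp
qed

lemma mult_odd_sum_antimono:
  assumes "1 \<le> x" "x \<le> y"
  shows "y * odd_sum k y \<le> x * odd_sum k x"
proof (cases k)
  case 0 then show ?thesis by (simp add: odd_sum_def)
next
  case (Suc k')
  have a: "y * odd_sum k y \<le> x * odd_sum k x" if xy: "3 \<le> x" "x \<le> y" for x y
  proof -
    obtain \<xi> where "x \<le> \<xi>"
      "x * odd_sum (Suc k') x - y * odd_sum (Suc k') y = even_sum k' (\<xi> - 1) * (y - x)"
      using odd_sum_mvt[OF xy] .
    moreover have "even_sum k' (\<xi> - 1) * (y - x) \<ge> 0"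
      using even_sum_nonneg[of "\<xi> - 1" k'] \<open>x \<le> \<xi>\<close> xy by simp
    ultimately show ?thesis by (simp add: Suc)
  qed
  have b: "y * odd_sum k y \<le> x * odd_sum k x" if "1 \<le> x" "x \<le> y" "y \<le> 3" for x y
    using odd_sum_explicit[of x k'] odd_sum_explicit[of y k'] that Suc by simp
  consider "y \<le> 3" | "3 \<le> x" | "x \<le> 3" "3 \<le> y" by linarith
  then show ?thesis
  proof cases
    case 3
    then have "y * odd_sum k y \<le> 3 * odd_sum k 3" "3 * odd_sum k 3 \<le> x * odd_sum k x"
      using a[of 3 y] b[of x 3] assms by auto
    then show ?thesis by simp
  qed (use a b assms in auto)
qed

lemma even_sum_antimono:
  assumes "2 \<le> x" "x \<le> y"
  shows "even_sum k y \<le> even_sum k x"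
proof -
  have "x * even_sum k y \<le> y * even_sum k y" using even_sum_nonneg assms by (intro mult_right_mono) auto
  then have "x * even_sum k y \<le> x * even_sum k x" using mult_even_sum_antimono[OF assms, of k] by simp
  then show ?thesis using assms by simp
qed

lemma odd_sum_antimono:
  assumes "1 \<le> x" "x \<le> y"
  shows "odd_sum k y \<le> odd_sum k x"
proof -
  have "x * odd_sum k y \<le> y * odd_sum k y" using odd_sum_nonneg assms by (intro mult_right_mono) auto
  then have "x * odd_sum k y \<le> x * odd_sum k x" using mult_odd_sum_antimono[OF assms, of k] by simp
  then show ?thesis using assms by simp
qed

text \<open>This puts \<open>x * even_sum k x\<close> in the role of the integral of
  \<open>odd_sum k (t - 1)\<close>, in the form that \<open>partial_summation\<close> asks of
  \<open>\<Psi>\<close>.\<close>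

lemma even_sum_drop:
  assumes "2 \<le> x" "x \<le> y"
  shows "odd_sum k (y - 1) * (y - x) \<le> x * even_sum k x - y * even_sum k y"
proof -
  obtain \<xi> where \<xi>: "x \<le> \<xi>" "\<xi> \<le> y" "x * even_sum k x - y * even_sum k y = odd_sum k (\<xi> - 1) * (y - x)"
    using even_sum_mvt[OF assms] .
  have "odd_sum k (y - 1) * (y - x) \<le> odd_sum k (\<xi> - 1) * (y - x)"
    using assms \<xi> by (intro mult_right_mono odd_sum_antimono) auto
  then show ?thesis using \<xi> by simp
qed

lemma odd_sum_drop:
  assumes "3 \<le> x" "x \<le> y"
  shows "even_sum k (y - 1) * (y - x) \<le> x * odd_sum (Suc k) x - y * odd_sum (Suc k) y"
proof -
  obtain \<xi> where \<xi>: "x \<le> \<xi>" "\<xi> \<le> y"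
    "x * odd_sum (Suc k) x - y * odd_sum (Suc k) y = even_sum k (\<xi> - 1) * (y - x)"
    using odd_sum_mvt[OF assms] .
  have "even_sum k (y - 1) * (y - x) \<le> even_sum k (\<xi> - 1) * (y - x)"
    using assms \<xi> by (intro mult_right_mono even_sum_antimono) auto
  then show ?thesis using \<xi> by simp
qed

lemma even_sum_explicit:
  assumes "2 \<le> s" "s \<le> 4"
  shows "s * even_sum (Suc k) s = 2 * even_sum (Suc k) 2 - cst (Suc k) * ln (s - 1) + s - 2"
proof -
  let ?F = "\<lambda>s. s * even_sum (Suc k) s + cst (Suc k) * ln (s - 1) - s"
  have "(?F has_real_derivative 0) (at s within {2..4})" if "2 \<le> s" "s \<le> 4" for s
  proof -
    have 1: "((\<lambda>s. s * even_sum (Suc k) s) has_real_derivative - odd_sum (Suc k) (s - 1)) (at s within {2..4})"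
      using that by (intro has_field_derivative_subset[OF even_sum_deriv]) auto
    have 2: "((\<lambda>s. cst (Suc k) * ln (s - 1)) has_real_derivative cst (Suc k) / (s - 1))
        (at s within {2..4})"
      using that by (auto intro!: derivative_eq_intros)
    have "odd_sum (Suc k) (s - 1) = cst (Suc k) / (s - 1) - 1"
      using odd_sum_explicit[of "s - 1" k] that by (simp add: field_simps)
    then show ?thesis
      by (intro DERIV_cong[OF DERIV_diff[OF DERIV_add[OF 1 2] DERIV_ident]]) simp
  qed
  then have "?F s = ?F 2" using assms by (intro constant_of_deriv_zero[of 2 4 ?F]) auto
  then show ?thesis by simp
qed

text \<open>Let \<open>G = odd_sum + even_sum\<close>. For the full series, where \<open>G = F - f\<close>, the quantity
  \<open>s (s - 1) G(s) - \<integral> x G(x) dx\<close> over \<open>[s - 1, s]\<close> is constant; for partial sums it increases to \<open>0\<close>.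
  At \<open>s = 3\<close> the logarithms cancel and what is left bounds \<open>even_sum k 2\<close>.\<close>

lemma even_sum_2_le: "2 * even_sum k 2 \<le> 2"
proof (cases k)
  case 0 then show ?thesis by (simp add: even_sum_def)
next
  case (Suc k')
  define G where "G = (\<lambda>s. odd_sum k s + even_sum k s)"
  define I where "I = (\<lambda>s. integral {2..s} (\<lambda>x. x * G x))"
  have cont: "continuous_on {2..} (\<lambda>x. x * G x)"
  proof -
    have "continuous_on {2..} (\<lambda>x. x * even_sum k x)"
      by (rule DERIV_continuous_on[OF even_sum_deriv]) auto
    moreover have "continuous_on ({2..3} \<union> {3..}) (\<lambda>x. x * odd_sum k x)"
    proof (rule continuous_on_closed_Un)
      have "continuous_on {2..3} (\<lambda>x. cst k - x)" by (intro continuous_intros)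
      then show "continuous_on {2..3} (\<lambda>x. x * odd_sum k x)"
        by (rule continuous_on_eq) (simp add: odd_sum_explicit Suc)
      show "continuous_on {3..} (\<lambda>x. x * odd_sum k x)" unfolding Suc
        by (rule DERIV_continuous_on[OF odd_sum_deriv]) auto
    qed auto
    moreover have "{2..3} \<union> {3..} = {2::real..}" by auto
    ultimately show ?thesis unfolding G_def distrib_left
      by (auto intro!: continuous_on_add)
  qed
  have DI: "(I has_real_derivative s * G s) (at s within {2..})" if "s \<ge> 2" for s
  proof -
    have "(I has_real_derivative s * G s) (at s within {2..s + 1})"
      unfolding I_def by (rule integral_has_real_derivative)
        (use that cont in \<open>auto intro: continuous_on_subset\<close>)
    moreover have "at s within {2..s + 1} = at s within {2..}"
      by (rule at_within_nhd[of _ "{..<s + 1}"]) auto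
    ultimately show ?thesis by simp
  qed
  define E where "E = (\<lambda>s. (s - 1) * (s * odd_sum k s + s * even_sum k s) - (I s - I (s - 1)))"
  \<comment> \<open>The difference of the two even sums is the last term \<open>f (2 * k)\<close>.
    Truncation thus gives \<open>E\<close> a nonnegative derivative where the full series would give
    0.\<close>
  define e where "e = (\<lambda>s. (s - 1) * (even_sum k (s - 1) - even_sum k' (s - 1)))"
  have DE: "(E has_real_derivative e s) (at s within {3..})" if "s \<ge> 3" for s
  proof -
    have img: "(\<lambda>t. t - 1) ` {3..} = {2::real..}"
    proof (intro equalityI subsetI)
      show "x \<in> (\<lambda>t. t - 1) ` {3..}" if "x \<in> {2..}" for x :: real
        using that by (intro image_eqI[of _ _ "x + 1"]) auto
    qed auto
    have "(I has_real_derivative (s - 1) * G (s - 1)) (at (s - 1) within (\<lambda>t. t - 1) ` {3..})"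
      unfolding img using DI[of "s - 1"] that by simp
    moreover have 0: "((\<lambda>t. t - 1) has_real_derivative 1) (at s within {3..})"
      by (auto intro!: derivative_eq_intros)
    ultimately have 1: "((\<lambda>s. I (s - 1)) has_real_derivative (s - 1) * G (s - 1)) (at s within {3..})"
      using DERIV_image_chain[of I _ "\<lambda>t. t - 1"] by (fastforce simp: o_def)
    have 2: "(I has_real_derivative s * G s) (at s within {3..})"
      using that by (intro has_field_derivative_subset[OF DI]) auto
    have 3: "((\<lambda>t. t * even_sum k t) has_real_derivative - odd_sum k (s - 1)) (at s within {3..})"
      using that by (intro has_field_derivative_subset[OF even_sum_deriv]) auto
    have 4: "((\<lambda>t. t * odd_sum k t) has_real_derivative - even_sum k' (s - 1)) (at s within {3..})"
      using odd_sum_deriv[OF that, of k'] Suc by simp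
    show ?thesis unfolding E_def e_def
      by (rule DERIV_cong[OF DERIV_diff[OF DERIV_mult[OF 0 DERIV_add[OF 4 3]] DERIV_diff[OF 2 1]]])
        (simp add: G_def Suc algebra_simps)
  qed
  define M where "M = 2 * real k + 5"
  have "E 3 \<le> E M"
  proof -
    obtain \<xi> where "3 \<le> \<xi>" "E M - E 3 = e \<xi> * (M - 3)"
      using mvt_halfline[OF DE, of 3 M] by (auto simp: M_def)
    moreover have "even_sum k' (\<xi> - 1) \<le> even_sum k (\<xi> - 1)"
      using f_nonneg[of k'] \<open>3 \<le> \<xi>\<close> by (simp add: Suc even_sum_def)
    then have "e \<xi> * (M - 3) \<ge> 0" using \<open>3 \<le> \<xi>\<close> by (simp add: e_def M_def)
    ultimately show ?thesis by simp
  qed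
  also have "E M \<le> 0"
  proof -
    obtain \<xi> where "M - 1 \<le> \<xi>" "I M - I (M - 1) = \<xi> * G \<xi> * (M - (M - 1))"
      using mvt_halfline[OF DI, of "M - 1" M] by (auto simp: M_def)
    moreover from this have "G \<xi> \<ge> 0" using odd_sum_nonneg[of \<xi> k] even_sum_nonneg[of \<xi> k]
      by (simp add: G_def M_def)
    ultimately have "I M - I (M - 1) \<ge> 0" using \<open>M - 1 \<le> \<xi>\<close> by (simp add: M_def)
    moreover have "odd_sum k M = 0" "even_sum k M = 0" by (auto intro!: odd_sum_vanish even_sum_vanish simp: M_def)
    ultimately show ?thesis by (simp add: E_def)
  qed
  \<comment> \<open>At s = 3 the integral runs over [2, 3], where both sums are known in terms of
    \<open>cst k\<close>, \<open>even_sum k 2\<close> and a logarithm.\<close>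
  finally have E3: "2 * (3 * odd_sum k 3 + 3 * even_sum k 3) \<le> I 3"
    by (simp add: E_def I_def)
  let ?c = "cst k" and ?b = "even_sum k 2"
  define H where "H = (\<lambda>x. (?c + 2 * ?b - 2) * x - ?c * ((x - 1) * ln (x - 1) - (x - 1)))"
  have "I 3 = H 3 - H 2"
    unfolding I_def
  proof (rule integral_unique, rule fundamental_theorem_of_calculus)
    fix x :: real assume x: "x \<in> {2..3}"
    have "x * G x = ?c + 2 * ?b - 2 - ?c * ln (x - 1)"
      unfolding G_def distrib_left Suc using odd_sum_explicit[of x k'] even_sum_explicit[of x k'] x by simp
    moreover have D: "((\<lambda>x. (x - 1) * ln (x - 1)) has_real_derivative ln (x - 1) + 1) (at x within {2..3})"
      using x by (auto intro!: derivative_eq_intros)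
    ultimately show "(H has_vector_derivative x * G x) (at x within {2..3})"
      unfolding H_def has_real_derivative_iff_has_vector_derivative[symmetric]
      by (intro DERIV_cong[OF DERIV_diff[OF DERIV_cmult[OF DERIV_ident]
            DERIV_cmult[OF DERIV_diff[OF D DERIV_diff[OF DERIV_ident DERIV_const]]]]]) simp
  qed simp
  moreover have "3 * odd_sum k 3 = ?c - 3" "3 * even_sum k 3 = 2 * ?b - ?c * ln 2 + 1"
    unfolding Suc using odd_sum_explicit[of 3 k'] even_sum_explicit[of 3 k'] by simp_all
  \<comment> \<open>Both sides of \<open>E3\<close> contain \<open>2 * ?c - 2 * ?c * ln 2\<close>;
    what remains is \<open>4 * ?b - 4 \<le> 2 * ?b - 2\<close>.\<close>
  ultimately show ?thesis using E3 by (simp add: H_def algebra_simps)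
qed

text \<open>The limit of \<open>cst k\<close> is \<open>2 e\<^sup>\<gamma> = 3.562...\<close>.\<close>

lemma cst_le: "cst k \<le> 365 / 100"
proof (cases k)
  case 0 then show ?thesis by (simp add: cst_def odd_sum_def)
next
  case (Suc k')
  have "cst k * ln 3 = 2 * even_sum k 2 + 2 - 4 * even_sum k 4"
    unfolding Suc using even_sum_explicit[of 4 k'] by simp
  also have "\<dots> \<le> 4" using even_sum_2_le[of k] even_sum_nonneg[of 4 k] by simp
  finally have "cst k * ln 3 \<le> 4" .
  moreover have "cst k * (400 / 365) \<le> cst k * ln 3"
    using cst_ge[of k] ln_3_ge by (intro mult_left_mono) auto
  ultimately show ?thesis by simp
qed

section \<open>Numerical bounds for the partial sums\<close>

lemma even_sum_3_le: "3 * even_sum k 3 \<le> 1"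
proof (cases k)
  case 0 then show ?thesis by (simp add: even_sum_def)
next
  case (Suc k')
  have "3 * (2 / 3) \<le> cst k * ln 2"
    using cst_ge[of k] ln2_ge_two_thirds by (intro mult_mono) auto
  then show ?thesis using even_sum_explicit[of 3 k'] even_sum_2_le[of k] unfolding Suc by auto
qed

lemma even_sum_le:
  assumes "2 \<le> s"
  shows "even_sum k s \<le> 2 / s"
proof -
  have "s * even_sum k s \<le> 2" using mult_even_sum_antimono[OF order_refl assms, of k] even_sum_2_le[of k] by linarith
  then show ?thesis using assms by (simp add: pos_le_divide_eq mult.commute)
qed

lemma odd_sum_le:
  assumes "1 \<le> s" "s \<le> 3"
  shows "odd_sum k s \<le> 365 / 100 / s - 1"
proof -
  have "s * odd_sum k s \<le> 365 / 100 - s"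
  proof (cases k)
    case 0 then show ?thesis using assms by (simp add: odd_sum_def)
  next
    case (Suc k')
    show ?thesis unfolding Suc odd_sum_explicit[OF assms] using cst_le by simp
  qed
  then have "odd_sum k s \<le> (365 / 100 - s) / s"
    using assms by (subst pos_le_divide_eq) (auto simp: mult.commute)
  also have "\<dots> = 365 / 100 / s - 1" using assms by (simp add: diff_divide_distrib)
  finally show ?thesis .
qed

lemma odd_sum_ge3_le:
  assumes "3 \<le> s"
  shows "odd_sum k s \<le> 65 / 100 / s"
proof -
  have "s * odd_sum k s \<le> 3 * odd_sum k 3" using mult_odd_sum_antimono[of 3 s k] assms by simp
  also have "\<dots> \<le> 65 / 100" using odd_sum_le[of 3 k] by simp
  finally show ?thesis using assms by (subst pos_le_divide_eq) (auto simp: mult.commute)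
qed

text \<open>Exponential decay, needed for large s in \<open>even_step\<close> and
  \<open>odd_step\<close>. The delay equation costs a factor 84/100 per step: 21/10 is 84/100 of
  5/2, and 84/100 of 21/10 is below 5/2. The value 5/2 itself is dictated by the direct bound on
  [2, 4] at its right end, where \<open>s * even_sum k s \<le> 1\<close> must be covered.\<close>

lemma sums_le_hnorm:
  "(\<forall>s\<ge>3. odd_sum k s \<le> 21 / 10 * hnorm s) \<and> (\<forall>s\<ge>2. even_sum k s \<le> 5 / 2 * hnorm s)"
proof (induction k)
  case 0
  then show ?case using hnorm_pos by (auto simp: odd_sum_def even_sum_def less_imp_le)
next
  case (Suc k)
  have 1: "odd_sum (Suc k) s \<le> 21 / 10 * hnorm s" if s: "3 \<le> s" for s
  proof -
    define M where "M = max s (2 * real k + 3)"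
    have M: "s \<le> M" "odd_sum (Suc k) M = 0" by (auto simp: M_def intro!: odd_sum_vanish)
    have "s * odd_sum (Suc k) s - M * odd_sum (Suc k) M \<le> 5 / 2 * hnorm_tail s - 5 / 2 * hnorm_tail M"
    proof (rule drop_compare[where u = "\<lambda>s. 5 / 2 * hnorm (s - 1)"])
      fix x y assume xy: "s \<le> x" "x \<le> y" "y \<le> M"
      obtain \<xi> where \<xi>: "x \<le> \<xi>"
        "x * odd_sum (Suc k) x - y * odd_sum (Suc k) y = even_sum k (\<xi> - 1) * (y - x)"
        using odd_sum_mvt[OF order_trans[OF s xy(1)] xy(2)] .
      have "even_sum k (\<xi> - 1) \<le> 5 / 2 * hnorm (\<xi> - 1)" using Suc \<xi> xy s by auto
      also have "\<dots> \<le> 5 / 2 * hnorm (x - 1)" using \<xi> xy s by (simp add: hnorm_antimono)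
      finally have "even_sum k (\<xi> - 1) * (y - x) \<le> 5 / 2 * hnorm (x - 1) * (y - x)"
        using xy by (intro mult_right_mono) auto
      then show "x * odd_sum (Suc k) x - y * odd_sum (Suc k) y \<le> 5 / 2 * hnorm (x - 1) * (y - x)"
        using \<xi>(2) by linarith
      show "5 / 2 * hnorm (y - 1) * (y - x) \<le> 5 / 2 * hnorm_tail x - 5 / 2 * hnorm_tail y"
        using hnorm_tail_drop[of x y] xy s by simp
    qed fact
    then have "s * odd_sum (Suc k) s \<le> 5 / 2 * hnorm_tail s - 5 / 2 * hnorm_tail M" by (simp add: M)
    moreover have "hnorm_tail M \<ge> 0" using M s by (intro hnorm_tail_nonneg) simp
    moreover have "s * (21 / 10 * hnorm s) = 21 / 10 * (s * hnorm s)" by simp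
    ultimately have "s * odd_sum (Suc k) s \<le> s * (21 / 10 * hnorm s)"
      using hnorm_tail_ge3_le[OF s] by linarith
    then show ?thesis using s by (simp only: mult_le_cancel_left_pos)
  qed
  have "even_sum (Suc k) s \<le> 5 / 2 * hnorm s" if s: "2 \<le> s" for s
  proof -
    consider "s \<le> 3" | "3 \<le> s" "s \<le> 4" | "4 \<le> s" by linarith
    then have "s * even_sum (Suc k) s \<le> s * (5 / 2 * hnorm s)"
    proof cases
      case 1
      have "s * (5 / 2 * hnorm s) = 5 / 2 * (s * exp (2 - s))" using s 1 by (simp add: hnorm_23)
      moreover have "s * even_sum (Suc k) s \<le> 2"
        using mult_even_sum_antimono[OF order_refl s, of "Suc k"] even_sum_2_le[of "Suc k"] by linarith
      ultimately show ?thesis using one_le_mult_exp[OF s 1] by linarith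
    next
      case 2
      have "exp (-2) \<ge> 2 / (15 :: real)" by (rule exp_minus_2_ge)
      moreover have "exp (-2) \<le> exp (2 - s)" using 2 by simp
      moreover have "s * (5 / 2 * hnorm s) = 5 / 2 * (3 * exp (2 - s))" using 2 by (simp add: hnorm_ge3)
      moreover have "s * even_sum (Suc k) s \<le> 1"
        using mult_even_sum_antimono[of 3 s "Suc k"] even_sum_3_le[of "Suc k"] 2 by simp
      ultimately show ?thesis by linarith
    next
      case 3
      define M where "M = max s (2 * real k + 4)"
      have M: "s \<le> M" "even_sum (Suc k) M = 0" by (auto simp: M_def intro!: even_sum_vanish)
      have "s * even_sum (Suc k) s - M * even_sum (Suc k) M \<le> 21 / 10 * hnorm_tail s - 21 / 10 * hnorm_tail M"
      proof (rule drop_compare[where u = "\<lambda>s. 21 / 10 * hnorm (s - 1)"])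
        fix x y assume xy: "s \<le> x" "x \<le> y" "y \<le> M"
        obtain \<xi> where \<xi>: "x \<le> \<xi>"
          "x * even_sum (Suc k) x - y * even_sum (Suc k) y = odd_sum (Suc k) (\<xi> - 1) * (y - x)"
          using even_sum_mvt[OF order_trans[OF s xy(1)] xy(2)] .
        have "odd_sum (Suc k) (\<xi> - 1) \<le> 21 / 10 * hnorm (\<xi> - 1)" using 1[of "\<xi> - 1"] \<xi> xy 3 by auto
        also have "\<dots> \<le> 21 / 10 * hnorm (x - 1)" using \<xi> xy s by (simp add: hnorm_antimono)
        finally have "odd_sum (Suc k) (\<xi> - 1) * (y - x) \<le> 21 / 10 * hnorm (x - 1) * (y - x)"
          using xy by (intro mult_right_mono) auto
        then show "x * even_sum (Suc k) x - y * even_sum (Suc k) y \<le> 21 / 10 * hnorm (x - 1) * (y - x)"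
          using \<xi>(2) by linarith
        show "21 / 10 * hnorm (y - 1) * (y - x) \<le> 21 / 10 * hnorm_tail x - 21 / 10 * hnorm_tail y"
          using hnorm_tail_drop[of x y] xy s by simp
      qed fact
      then have "s * even_sum (Suc k) s \<le> 21 / 10 * hnorm_tail s - 21 / 10 * hnorm_tail M" by (simp add: M)
      moreover have "0 \<le> s * hnorm s" using hnorm_pos[of s] s by simp
      moreover have "hnorm_tail M \<ge> 0" using M s by (intro hnorm_tail_nonneg) simp
      moreover have "s * (5 / 2 * hnorm s) = 5 / 2 * (s * hnorm s)" by simp
      moreover have "hnorm_tail s \<le> 84 / 100 * (s * hnorm s)" using 3 by (intro hnorm_tail_ge3_le) simp
      ultimately show ?thesis by linarith
    qed
    then show ?thesis using s by (simp only: mult_le_cancel_left_pos)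
  qed
  with 1 show ?case by blast
qed

text \<open>The constants 161 and 283/2 solve the induction with little room: going from the upper to
  the lower bound costs the most at \<open>s = 2\<close>, from the lower to the upper one at \<open>s = 3\<close>, and the
  extension of the upper bound to \<open>s \<le> 3\<close> at \<open>s = 1\<close>.\<close>

lemma even_step:
  assumes s: "2 \<le> s" and e: "0 \<le> e" "e \<le> 1 / 200"
  shows "odd_sum k (s - 1) + even_sum k s + 161 * (e * hnorm (s - 1) + (1 + e) * (hnorm_tail s / s)) \<le> 161 * hnorm s"
proof -
  have "0 \<le> hnorm (s - 1)" "0 \<le> hnorm_tail s / s"
    using hnorm_pos[of "s - 1"] hnorm_tail_nonneg[of s] s by auto
  then have le: "e * hnorm (s - 1) + (1 + e) * (hnorm_tail s / s)
      \<le> 1 / 200 * hnorm (s - 1) + 201 / 200 * (hnorm_tail s / s)"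
    using e by (intro add_mono mult_right_mono) auto
  have "odd_sum k (s - 1) + even_sum k s + 161 * (1 / 200 * hnorm (s - 1) + 201 / 200 * (hnorm_tail s / s))
      \<le> 161 * hnorm s"
  proof -
    consider "s \<le> 3" | "3 \<le> s" "s \<le> 4" | "4 \<le> s" by linarith
    then show ?thesis
    proof cases
      case 1
      define x where "x = s - 2"
      have x: "0 \<le> x" "x \<le> 1" "s = 2 + x" using s 1 by (auto simp: x_def)
      have "exp (-1::real) \<ge> inverse (272 / 100)"
        unfolding exp_minus using e_less_272 by (intro le_imp_inverse_le) auto
      then have "hnorm_tail s \<le> 39265 / 10000 - s" using 1 by (simp add: hnorm_tail_def)
      then have J: "hnorm_tail s / s \<le> 39265 / 10000 / s - 1"
        using divide_right_mono[of "hnorm_tail s" "39265 / 10000 - s" s] s by (simp add: diff_divide_distrib)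
      \<comment> \<open>All terms of the claim on [2, 3]: 637.33 is 161 * 201/200 * 3.9265 rounded
        up, plus 2 from \<open>even_sum k s \<le> 2 / s\<close>; 3.65 comes from
        \<open>odd_sum\<close>, and 162 = 1 + 161 * 201/200 - 161/200. The slack at s = 2 is the
        137/100 below, against products of size about 646.\<close>
      have "63733 / 100 / (2 + x) + 365 / 100 / (1 + x) - 162 \<le> 161 * (1 - x + x\<^sup>2 / 2 - x ^ 3 / 6)"
      proof -
        have "x ^ 5 \<le> x ^ 3" using x by (intro power_decreasing) auto
        then have "0 \<le> 137 / 100 + 602 / 100 * x + x\<^sup>2 + 161 / 6 * (x ^ 3 - x ^ 5)"
          using x by simp
        also have "\<dots> = (2 + x) * (1 + x) * (161 * (1 - x + x\<^sup>2 / 2 - x ^ 3 / 6) + 162)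
            - (63733 / 100 * (1 + x) + 365 / 100 * (2 + x))"
          by (simp add: field_simps eval_nat_numeral)
        finally have "(63733 / 100 * (1 + x) + 365 / 100 * (2 + x)) / ((2 + x) * (1 + x))
            \<le> 161 * (1 - x + x\<^sup>2 / 2 - x ^ 3 / 6) + 162"
          using x by (subst pos_divide_le_eq) (auto simp: mult.commute)
        also have "(63733 / 100 * (1 + x) + 365 / 100 * (2 + x)) / ((2 + x) * (1 + x))
            = 63733 / 100 / (2 + x) + 365 / 100 / (1 + x)"
          by (rule add_frac_eq[symmetric]) (use x in auto)
        finally show ?thesis by simp
      qed
      also have "161 * (1 - x + x\<^sup>2 / 2 - x ^ 3 / 6) \<le> 161 * hnorm s"
        using exp_minus_ge_cubic[of x] hnorm_23[of s] s 1 by (simp add: x_def)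
      finally have main: "63733 / 100 / s + 365 / 100 / (s - 1) - 162 \<le> 161 * hnorm s"
        by (simp add: x_def)
      have "161 * 201 / 200 * (39265 / 10000 / s) \<le> 63533 / 100 / s"
        using s by (simp add: field_simps)
      moreover have "odd_sum k (s - 1) \<le> 365 / 100 / (s - 1) - 1" using odd_sum_le[of "s - 1" k] s 1 by simp
      moreover have "even_sum k s \<le> 2 / s" by (rule even_sum_le[OF s])
      moreover have "hnorm (s - 1) = 1" using 1 by (simp add: hnorm_le2)
      moreover have "63733 / 100 / s = 63533 / 100 / s + 2 / s" by (simp flip: add_divide_distrib)
      ultimately show ?thesis using J main by argo
    next
      case 2
      define X where "X = exp (2 - s)"
      have X: "X > 0" "X \<ge> 2 / 15"
      proof -
        have "exp (-2) \<le> X" using 2 by (simp add: X_def)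
        then show "X \<ge> 2 / 15" using exp_minus_2_ge by linarith
      qed (simp add: X_def)
      have eX: "exp (3 - s) \<le> 272 / 100 * X"
      proof -
        have "exp (3 - s) = exp 1 * X" by (simp add: X_def flip: exp_add)
        also have "\<dots> \<le> 272 / 100 * X" using e_less_272 X by (intro mult_right_mono) auto
        finally show ?thesis .
      qed
      have "s * odd_sum k (s - 1) \<le> s * (365 / 100 / (s - 1) - 1)"
        using odd_sum_le[of "s - 1" k] 2 by (intro mult_left_mono) auto
      also have "\<dots> = 365 / 100 + 365 / 100 / (s - 1) - s" using 2 by (simp add: field_simps)
      also have "\<dots> \<le> 365 / 100 + 365 / 100 / 2 - 3"
        using 2 by (intro diff_mono add_left_mono divide_left_mono) auto
      finally have "s * odd_sum k (s - 1) \<le> 365 / 100 + 365 / 100 / 2 - 3" .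
      moreover have "s * even_sum k s \<le> 1" using mult_even_sum_antimono[of 3 s k] even_sum_3_le[of k] 2 by simp
      moreover have "s * (161 * (1 / 200 * hnorm (s - 1))) \<le> 4 * (161 * (1 / 200 * (272 / 100 * X)))"
        using 2 eX X by (intro mult_mono) (auto simp: hnorm_23)
      moreover have "s * (161 * (201 / 200 * (hnorm_tail s / s))) = 161 * 201 / 200 * hnorm_tail s"
        using 2 by simp
      moreover have "hnorm_tail s \<le> exp (3 - s)" using 2 by (simp add: hnorm_tail_34)
      moreover have "s * (161 * hnorm s) = 483 * X" using 2 by (simp add: hnorm_ge3 X_def)
      ultimately have "s * (odd_sum k (s - 1)) + s * even_sum k s + s * (161 * (1 / 200 * hnorm (s - 1)))
          + s * (161 * (201 / 200 * (hnorm_tail s / s))) \<le> s * (161 * hnorm s)"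
        using eX X by linarith
      then have "s * (odd_sum k (s - 1) + even_sum k s + 161 * (1 / 200 * hnorm (s - 1) + 201 / 200 * (hnorm_tail s / s)))
          \<le> s * (161 * hnorm s)"
        by (simp only: distrib_left)
      then show ?thesis using s by (simp only: mult_le_cancel_left_pos)
    next
      case 3
      have "odd_sum k (s - 1) \<le> 21 / 10 * hnorm (s - 1)" "even_sum k s \<le> 5 / 2 * hnorm s"
        using sums_le_hnorm[of k] 3 by auto
      moreover have "hnorm_tail s / s \<le> 84 / 100 * hnorm s"
        using hnorm_tail_ge3_le[of s] 3 by (simp add: pos_divide_le_eq mult_ac)
      moreover have "hnorm s > 0" using 3 by (simp add: hnorm_pos)
      moreover note hnorm_shift[OF s]
      ultimately show ?thesis by argo
    qed
  qed
  then show ?thesis using le by argo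
qed

lemma odd_step:
  assumes s: "3 \<le> s" and e: "0 \<le> e" "e \<le> 1 / 200"
  shows "even_sum k (s - 1) + odd_sum l s + 161 * (e * hnorm (s - 1) + (1 + e) * (hnorm_tail s / s))
    \<le> 283 / 2 * hnorm s"
proof -
  have "0 \<le> hnorm (s - 1)" "0 \<le> hnorm_tail s / s"
    using hnorm_pos[of "s - 1"] hnorm_tail_nonneg[of s] s by auto
  then have le: "e * hnorm (s - 1) + (1 + e) * (hnorm_tail s / s)
      \<le> 1 / 200 * hnorm (s - 1) + 201 / 200 * (hnorm_tail s / s)"
    using e by (intro add_mono mult_right_mono) auto
  have "even_sum k (s - 1) + odd_sum l s + 161 * (1 / 200 * hnorm (s - 1) + 201 / 200 * (hnorm_tail s / s))
      \<le> 283 / 2 * hnorm s"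
  proof (cases "s \<le> 4")
    case True
    define X where "X = exp (2 - s)"
    have X: "X > 0" by (simp add: X_def)
    have eX: "exp (3 - s) = exp 1 * X" by (simp add: X_def flip: exp_add)
    \<comment> \<open>The estimate is linear in \<open>X\<close>, \<open>X * s\<close> and
      \<open>exp (-1)\<close>. This bound and \<open>3 * X \<le> X * s\<close> both become
      equalities at s = 3, so nothing is lost at the critical point.\<close>
    have lower: "X * (s - 2) \<le> exp (-1)"
    proof -
      have "X * (1 + (s - 3)) \<le> X * exp (s - 3)"
        using X by (intro mult_left_mono exp_ge_add_one_self) auto
      also have "\<dots> = exp (-1)" by (simp add: X_def flip: exp_add)
      finally show ?thesis by simp
    qed
    have "exp 1 * exp (-1) = (1::real)" by (simp flip: exp_add)
    moreover have "exp 1 * exp (-1) \<le> 272 / 100 * exp (-1::real)"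
      using e_less_272 by (intro mult_right_mono) auto
    ultimately have one: "1 \<le> 272 / 100 * exp (-1::real)" by simp
    have "s * even_sum k (s - 1) \<le> s * (2 / (s - 1))"
      using even_sum_le[of "s - 1" k] s by (intro mult_left_mono) auto
    also have "\<dots> \<le> 3" using s by (simp add: pos_divide_le_eq)
    finally have "s * even_sum k (s - 1) \<le> 3" .
    moreover have "s * odd_sum l s \<le> 65 / 100"
      using odd_sum_ge3_le[OF s, of l] s by (simp add: pos_le_divide_eq mult_ac)
    moreover have "s * (161 * (1 / 200 * hnorm (s - 1))) \<le> 161 / 200 * (272 / 100 * (X * s))"
    proof -
      have "exp 1 * (X * s) \<le> 272 / 100 * (X * s)"
        using e_less_272 X s by (intro mult_right_mono) auto
      then show ?thesis using s True by (simp add: hnorm_23 eX mult_ac)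
    qed
    moreover have "s * (161 * (201 / 200 * (hnorm_tail s / s))) = 161 * 201 / 200 * hnorm_tail s"
      using s by simp
    moreover have "hnorm_tail s \<le> 272 / 100 * X - exp (-1) / 5"
      using mult_right_mono[of "exp 1" "272 / 100" X] e_less_272 X s True by (simp add: hnorm_tail_34 eX)
    moreover have "s * (283 / 2 * hnorm s) = 849 / 2 * X" using s by (simp add: hnorm_ge3 X_def)
    moreover have "X * s - 2 * X \<le> exp (-1)" using lower by (simp add: algebra_simps)
    moreover have "3 * X \<le> X * s" using s X by simp
    ultimately have "s * even_sum k (s - 1) + s * odd_sum l s + s * (161 * (1 / 200 * hnorm (s - 1)))
        + s * (161 * (201 / 200 * (hnorm_tail s / s))) \<le> s * (283 / 2 * hnorm s)"
      using one X by linarith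
    then have "s * (even_sum k (s - 1) + odd_sum l s + 161 * (1 / 200 * hnorm (s - 1) + 201 / 200 * (hnorm_tail s / s)))
        \<le> s * (283 / 2 * hnorm s)"
      by (simp only: distrib_left)
    then show ?thesis using s by (simp only: mult_le_cancel_left_pos)
  next
    case False
    have "even_sum k (s - 1) \<le> 5 / 2 * hnorm (s - 1)" "odd_sum l s \<le> 21 / 10 * hnorm s"
      using sums_le_hnorm[of k] sums_le_hnorm[of l] False by auto
    moreover have h: "hnorm s > 0" using s by (simp add: hnorm_pos)
    moreover have "hnorm (s - 1) \<le> 4 * hnorm s" using s by (simp add: hnorm_shift)
    moreover have "hnorm_tail s / s \<le> 73 / 100 * hnorm s"
    proof -
      have "4 / 15 * exp 1 * (s * hnorm s) \<le> 73 / 100 * (s * hnorm s)"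
        using e_less_272 h s by (intro mult_right_mono) auto
      then have "hnorm_tail s \<le> 73 / 100 * (s * hnorm s)" using hnorm_tail_ge4_le[of s] False by linarith
      then show ?thesis using s by (simp add: pos_divide_le_eq mult_ac)
    qed
    ultimately show ?thesis by argo
  qed
  then show ?thesis using le by argo
qed

text \<open>The main terms agree exactly, because \<open>s * (1 + odd_sum (Suc k) s)\<close> is
  constant on [1, 3]; only the terms with a factor \<open>e\<close> are compared. As
  \<open>s * hnorm s\<close> is at least 1, with equality at s = 1, it suffices that 3.65 + 201/200
  * 849/2 / 2.7166 = 160.69... is below 161. Here 849/2 = 3 * 283/2.\<close>

lemma small_step:
  assumes s: "1 \<le> s" "s \<le> 3" and e: "0 \<le> e" "e \<le> 1 / 200"
  shows "(1 + e) * (3 / s) * (1 + odd_sum (Suc k) 3 + e * (283 / 2 * hnorm 3)) - 1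
    \<le> odd_sum (Suc k) s + e * (161 * hnorm s)"
proof -
  have "inverse (exp 1) \<le> inverse (27166 / 10000 :: real)"
    using exp_1_gt by (intro le_imp_inverse_le) auto
  then have h3: "hnorm 3 \<le> 10000 / 27166" by (simp add: hnorm_23 exp_minus)
  have h: "1 \<le> s * hnorm s"
    using s one_le_mult_exp[of s] by (cases "s \<le> 2") (auto simp: hnorm_le2 hnorm_23)
  have "(1 + e) * (849 / 2 * hnorm 3) \<le> 201 / 200 * (849 / 2 * (10000 / 27166))"
    using e h3 hnorm_pos[of 3] by (intro mult_mono) auto
  then have "cst (Suc k) + (1 + e) * (849 / 2 * hnorm 3) \<le> 161 * (s * hnorm s)"
    using cst_le[of "Suc k"] h by linarith
  then have "e * (cst (Suc k) + (1 + e) * (849 / 2 * hnorm 3)) \<le> e * (161 * (s * hnorm s))"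
    using e by (intro mult_left_mono) auto
  then have "(1 + e) * 3 * (1 + odd_sum (Suc k) 3 + e * (283 / 2 * hnorm 3)) - s
      \<le> s * odd_sum (Suc k) s + e * (161 * (s * hnorm s))"
    unfolding odd_sum_explicit[OF s] by (simp add: cst_def algebra_simps)
  moreover have "s * ((1 + e) * (3 / s) * Y - 1) = (1 + e) * 3 * Y - s" for Y
    using s by (simp add: right_diff_distrib)
  moreover have "s * (odd_sum (Suc k) s + e * (161 * hnorm s)) = s * odd_sum (Suc k) s + e * (161 * (s * hnorm s))"
    by (simp add: distrib_left)
  ultimately have "s * ((1 + e) * (3 / s) * (1 + odd_sum (Suc k) 3 + e * (283 / 2 * hnorm 3)) - 1)
      \<le> s * (odd_sum (Suc k) s + e * (161 * hnorm s))"
    by simp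
  then show ?thesis using s by (simp only: mult_le_cancel_left_pos)
qed

end

subsection \<open>Sieve weights and summation by parts\<close>

lemma less_nat_ceiling_iff: "p < nat \<lceil>z\<rceil> \<longleftrightarrow> real p < z"
  by linarith

text \<open>The sum of the Rosser--Iwaniec weights times \<open>g\<close> over the primes of \<open>S\<close> below \<open>n\<close>, organised by the
  largest prime; \<open>up\<close> selects the upper sieve. The recursion replaces the usual bookkeeping of the
  terms \<open>T\<^sub>n(D, z)\<close>.\<close>

fun sieve_sum :: "nat set \<Rightarrow> (nat \<Rightarrow> real) \<Rightarrow> bool \<Rightarrow> nat \<Rightarrow> real \<Rightarrow> real" where
  "sieve_sum S g up 0 D = 1"
| "sieve_sum S g up (Suc n) D = sieve_sum S g up n D -
     (if n \<in> S \<and> (up \<longrightarrow> real n ^ 3 < D) then g n * sieve_sum S g (\<not> up) n (D / real n) else 0)"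

text \<open>The support of the weights: a squarefree d is represented by its set of prime factors,
  and its weight is the parity sign of that set.\<close>

fun sieve_family :: "nat set \<Rightarrow> bool \<Rightarrow> nat \<Rightarrow> real \<Rightarrow> nat set set" where
  "sieve_family S up 0 D = {{}}"
| "sieve_family S up (Suc n) D = sieve_family S up n D \<union>
     (if n \<in> S \<and> (up \<longrightarrow> real n ^ 3 < D) then insert n ` sieve_family S (\<not> up) n (D / real n) else {})"

lemma sieve_family_sub: "I \<in> sieve_family S up n D \<Longrightarrow> I \<subseteq> S \<inter> {..<n}"
proof (induction S up n D arbitrary: I rule: sieve_family.induct)
  case (2 S up n D)
  then show ?case by (fastforce split: if_splits)
qed auto

lemma finite_sieve_family: "finite (sieve_family S up n D)"
  by (induction S up n D rule: sieve_family.induct) auto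

lemma sieve_sum_family:
  "sieve_sum S g up n D = (\<Sum>I\<in>sieve_family S up n D. (- 1) ^ card I * (\<Prod>p\<in>I. g p))"
proof (induction S g up n D rule: sieve_sum.induct)
  case (2 S g up n D)
  show ?case
  proof (cases "n \<in> S \<and> (up \<longrightarrow> real n ^ 3 < D)")
    case True
    let ?F = "sieve_family S (\<not> up) n (D / real n)"
    have nin: "n \<notin> I \<and> finite I" if "I \<in> sieve_family S up' n D'" for I up' D'
      using sieve_family_sub[OF that] by (auto intro: finite_subset)
    have inj: "inj_on (insert n) ?F"
      using nin by (metis Diff_insert_absorb inj_onI)
    have disj: "sieve_family S up n D \<inter> insert n ` ?F = {}"
      using nin by blast
    have "(\<Sum>I\<in>insert n ` ?F. (- 1) ^ card I * (\<Prod>p\<in>I. g p)) =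
        (\<Sum>I\<in>?F. - g n * ((- 1) ^ card I * (\<Prod>p\<in>I. g p)))"
      unfolding sum.reindex[OF inj] o_def by (rule sum.cong) (use nin in auto)
    also have "\<dots> = - g n * sieve_sum S g (\<not> up) n (D / real n)"
      using 2 True by (simp add: sum_distrib_left)
    finally show ?thesis
      using True 2 disj by (simp add: sum.union_disjoint finite_sieve_family)
  qed (use 2 in auto)
qed simp

text \<open>The lower sieve does not restrict the largest prime, so \<open>p\<^sup>2 < D\<close> has to be supplied there.\<close>

lemma sieve_family_prod_less:
  assumes "I \<in> sieve_family S up n D" "D > 1" "\<And>p. p \<in> S \<Longrightarrow> 2 \<le> p"
    and "\<not> up \<Longrightarrow> (\<forall>p\<in>S. p < n \<longrightarrow> real p ^ 2 < D)"
  shows "real (\<Prod>I) < D"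
  using assms
proof (induction S up n D arbitrary: I rule: sieve_family.induct)
  case (2 S up n D)
  show ?case
  proof (cases "I \<in> sieve_family S up n D")
    case True
    then show ?thesis using 2(1)[OF True] 2(4-6) by (meson less_Suc_eq)
  next
    case False
    then have n: "n \<in> S" "up \<longrightarrow> real n ^ 3 < D"
      and "I \<in> insert n ` sieve_family S (\<not> up) n (D / real n)"
      using 2(3) by (auto split: if_splits)
    then obtain J where J: "J \<in> sieve_family S (\<not> up) n (D / real n)" "I = insert n J" by auto
    have n2: "n \<ge> 2" using 2 n by blast
    have sq: "real n ^ 2 < D"
    proof (cases up)
      case True
      have "real n ^ 2 \<le> real n ^ 3" using n2 by (intro power_increasing) auto
      then show ?thesis using n True by simp
    qed (use 2(6) n in auto)
    have "real n < D / real n" using sq n2 by (simp add: pos_less_divide_eq power2_eq_square)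
    then have "D / real n > 1" using n2 by linarith
    \<comment> \<open>The condition \<open>real n ^ 3 < D\<close> of the upper sieve supplies what
      the lower sieve of level \<open>D / real n\<close> requires of the primes below
      \<open>n\<close>.\<close>
    moreover have "real p ^ 2 < D / real n" if "\<not> \<not> up" "p \<in> S" "p < n" for p
    proof -
      have "real p ^ 2 * real n \<le> real n ^ 2 * real n" using that by (intro mult_right_mono power_mono) auto
      also have "\<dots> < D" using n that by (simp add: power3_eq_cube power2_eq_square)
      finally show ?thesis using n2 by (simp add: pos_less_divide_eq)
    qed
    ultimately have "real (\<Prod>J) < D / real n"
      using 2(2)[OF _ J(1)] n 2(5) by blast
    moreover have "n \<notin> J" "finite J" using sieve_family_sub[OF J(1)] by (auto intro: finite_subset)
    ultimately show ?thesis using n2 by (simp add: J pos_less_divide_eq mult.commute)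
  qed
qed simp

section \<open>Euler products and recursion on the largest prime\<close>

definition euler_prod :: "nat set \<Rightarrow> (nat \<Rightarrow> real) \<Rightarrow> nat \<Rightarrow> real" where
  "euler_prod S g n = (\<Prod>p\<in>S \<inter> {..<n}. 1 - g p)"

lemma euler_prod_0 [simp]: "euler_prod S g 0 = 1"
  by (simp add: euler_prod_def)

lemma euler_prod_Suc:
  "euler_prod S g (Suc n) = (if n \<in> S then euler_prod S g n * (1 - g n) else euler_prod S g n)"
  by (auto simp: euler_prod_def lessThan_Suc Int_insert_right mult.commute)

text \<open>The two inequalities feed each other, since a subtracted sum is of the opposite kind. A
  term can be omitted only in the upper sieve, and the sum left there is at least the old product,
  hence at least the new one.\<close>

lemma sieve_sum_indicator:
  fixes g :: "nat \<Rightarrow> real"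
  assumes "\<And>p. g p = 0 \<or> g p = 1"
  shows "euler_prod S g n \<le> sieve_sum S g True n D \<and> sieve_sum S g False n D' \<le> euler_prod S g n"
proof (induction n arbitrary: D D')
  case (Suc n)
  have V0: "euler_prod S g n \<ge> 0" unfolding euler_prod_def
    using assms(1) by (intro prod_nonneg) (metis diff_ge_0_iff_ge order_refl zero_le_one)
  have "euler_prod S g n \<le> sieve_sum S g True n D"
    "sieve_sum S g False n (D / real n) \<le> euler_prod S g n"
    "euler_prod S g n \<le> sieve_sum S g True n (D' / real n)"
    "sieve_sum S g False n D' \<le> euler_prod S g n"
    using Suc by auto
  then show ?case using V0 assms(1)[of n] by (auto simp: euler_prod_Suc)
qed simp

lemma euler_prod_telescope:
  "euler_prod S g n = 1 - (\<Sum>p\<in>S \<inter> {..<n}. g p * euler_prod S g p)"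
proof (induction n)
  case (Suc n)
  then show ?case by (simp add: euler_prod_Suc lessThan_Suc Int_insert_right algebra_simps)
qed simp

text \<open>Shaped like \<open>euler_prod_telescope\<close>, so that when no prime is excluded by
  the cube condition the two subtract term by term, leaving the differences
  \<open>sieve_sum S g (\<not> up) p (D / real p) - euler_prod S g p\<close>.\<close>

lemma sieve_sum_expand:
  "sieve_sum S g up n D = 1 - (\<Sum>p\<in>{p \<in> S. p < n \<and> (up \<longrightarrow> real p ^ 3 < D)}.
     g p * sieve_sum S g (\<not> up) p (D / real p))"
proof (induction n)
  case (Suc n)
  let ?R = "\<lambda>n. {p \<in> S. p < n \<and> (up \<longrightarrow> real p ^ 3 < D)}"
  show ?case
  proof (cases "n \<in> S \<and> (up \<longrightarrow> real n ^ 3 < D)")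
    case True
    then have "?R (Suc n) = insert n (?R n)" by (auto simp: less_Suc_eq)
    then show ?thesis using Suc True by simp
  next
    case False
    then have "?R (Suc n) = ?R n" by (auto simp: less_Suc_eq)
    then show ?thesis using Suc False by (simp only: sieve_sum.simps if_False diff_zero)
  qed
qed simp

text \<open>Summation by parts against \<open>V(u) / V(z) \<le> (1 + e) log z / log u\<close>, where
  \<open>\<Psi>\<close> plays the role of \<open>\<integral>\<^sub>s \<phi>(t - 1) dt\<close>.\<close>

lemma partial_summation:
  fixes \<phi> \<Psi> :: "real \<Rightarrow> real" and S g D z
  defines "V \<equiv> euler_prod S g" and "N \<equiv> nat \<lceil>z\<rceil>" and "s \<equiv> ln D / ln z"
  assumes S: "\<And>p. p \<in> S \<Longrightarrow> 2 \<le> p" and z: "1 < z" and D: "1 < D" and e: "0 \<le> e"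
    and V: "\<And>n. 0 \<le> V n"
    and dens: "\<And>i. 2 \<le> i \<Longrightarrow> real i < z \<Longrightarrow> V i \<le> (1 + e) * (ln z / ln (real i)) * V N"
    and \<phi>: "\<And>x. s \<le> x \<Longrightarrow> 0 \<le> \<phi> (x - 1)"
      "\<And>x y. s \<le> x \<Longrightarrow> x \<le> y \<Longrightarrow> \<phi> (y - 1) \<le> \<phi> (x - 1)"
    and \<Psi>: "\<And>x. s \<le> x \<Longrightarrow> 0 \<le> \<Psi> x"
      "\<And>x y. s \<le> x \<Longrightarrow> x \<le> y \<Longrightarrow> \<phi> (y - 1) * (y - x) \<le> \<Psi> x - \<Psi> y"
  shows "(\<Sum>p\<in>S \<inter> {..<N}. g p * V p * \<phi> (ln D / ln (real p) - 1))
    \<le> V N * (e * \<phi> (s - 1) + (1 + e) * (\<Psi> s / s))"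
proof -
  define t where "t = (\<lambda>i::nat. ln D / ln (real i))"
  \<comment> \<open>Chosen so that the density bound reads \<open>V i \<le> c * t i\<close>, with
    \<open>c * s = (1 + e) * V N\<close>.\<close>
  define c where "c = (1 + e) / s * V N"
  have lnz: "ln z > 0" and lnD: "ln D > 0" and s: "s > 0" using z D by (auto simp: s_def)
  have t: "s \<le> t i" if "2 \<le> i" "real i < z" for i
    using that lnD by (auto simp: s_def t_def intro!: divide_left_mono)
  have tm: "t j \<le> t i" if "2 \<le> i" "i \<le> j" for i j
    using that lnD by (auto simp: t_def intro!: divide_left_mono)
  have c: "c \<ge> 0" using e s V by (simp add: c_def)
  have Vc: "V i \<le> c * t i" if "2 \<le> i" "real i < z" for i
  proof -
    have "ln z / ln (real i) = t i / s" using lnz lnD by (simp add: t_def s_def)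
    then show ?thesis using dens[OF that] by (simp add: c_def mult_ac)
  qed
  have lt: "real i < z" if "i < N" for i using that by (simp add: N_def) linarith
  have base: "(\<Sum>p\<in>S \<inter> {..<N}. g p * V p * \<phi> (t p - 1)) = (\<Sum>i=2..<N. (V i - V (Suc i)) * \<phi> (t i - 1))"
  proof -
    have "(\<Sum>i=2..<N. (V i - V (Suc i)) * \<phi> (t i - 1)) =
        (\<Sum>i=2..<N. if i \<in> S then g i * V i * \<phi> (t i - 1) else 0)"
      by (rule sum.cong) (auto simp: V_def euler_prod_Suc algebra_simps)
    also have "\<dots> = (\<Sum>i\<in>{2..<N} \<inter> S. g i * V i * \<phi> (t i - 1))"
      by (simp add: sum.inter_restrict)
    also have "{2..<N} \<inter> S = S \<inter> {..<N}" using S by auto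
    finally show ?thesis by simp
  qed
  \<comment> \<open>Carrying the boundary term makes each increment equal to
    \<open>V (Suc M)\<close> times an increase of \<open>\<phi>\<close> along the decreasing
    sequence \<open>t\<close>; that factor is nonnegative, so the bound for \<open>V\<close> may be
    inserted.\<close>
  have step: "(\<Sum>i=2..<Suc M. (V i - V (Suc i)) * \<phi> (t i - 1)) + V (Suc M) * \<phi> (t M - 1)
      \<le> c * (\<Psi> (t M) + t M * \<phi> (t M - 1))" if "2 \<le> M" "M < N" for M
    using that
  proof (induction M rule: dec_induct)
    case base
    have "V 2 * \<phi> (t 2 - 1) \<le> c * t 2 * \<phi> (t 2 - 1)"
      using base Vc[of 2] lt[of 2] \<phi>(1)[OF t, of 2] by (intro mult_right_mono) auto
    also have "\<dots> \<le> c * (\<Psi> (t 2) + t 2 * \<phi> (t 2 - 1))"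
      using base lt[of 2] \<Psi>(1)[OF t, of 2] c by (simp add: distrib_left)
    finally show ?case by (simp add: algebra_simps eval_nat_numeral)
  next
    case (step M)
    let ?x = "t (Suc M)" and ?y = "t M"
    have xy: "s \<le> ?x" "?x \<le> ?y" using step lt[of "Suc M"] by (auto intro!: t tm)
    have "V (Suc M) * (\<phi> (?x - 1) - \<phi> (?y - 1)) \<le> c * ?x * (\<phi> (?x - 1) - \<phi> (?y - 1))"
      using step lt[of "Suc M"] \<phi>(2)[OF xy] by (intro mult_right_mono Vc) auto
    moreover have "c * (\<phi> (?y - 1) * (?y - ?x)) \<le> c * (\<Psi> ?x - \<Psi> ?y)"
      using c \<Psi>(2)[OF xy] by (intro mult_left_mono) auto
    ultimately show ?case using step by (simp add: algebra_simps)
  qed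
  have "(\<Sum>i=2..<N. (V i - V (Suc i)) * \<phi> (t i - 1))
    \<le> V N * (e * \<phi> (s - 1) + (1 + e) * (\<Psi> s / s))"
  proof (cases "N \<le> 2")
    case True
    then show ?thesis using V[of N] e s \<phi>(1)[of s] \<Psi>(1)[of s] by simp
  next
    case False
    then obtain M where M: "N = Suc M" "2 \<le> M" by (cases N) auto
    have st: "s \<le> t M" using t[of M] lt[of M] M by simp
    have "(\<Sum>i=2..<N. (V i - V (Suc i)) * \<phi> (t i - 1)) + V N * \<phi> (t M - 1)
        \<le> c * (\<Psi> (t M) + t M * \<phi> (t M - 1))"
      using step[of M] M by simp
    also have "\<dots> \<le> c * (\<Psi> s + s * \<phi> (t M - 1))"
      using \<Psi>(2)[of s "t M"] st c by (intro mult_left_mono) (auto simp: algebra_simps)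
    also have "\<dots> = V N * ((1 + e) * (\<Psi> s / s) + (1 + e) * \<phi> (t M - 1))"
      using s by (simp add: c_def field_simps)
    \<comment> \<open>Moving the boundary term to the right leaves only \<open>e\<close> of the
      factor \<open>1 + e\<close> on \<open>\<phi>\<close>.\<close>
    finally have "(\<Sum>i=2..<N. (V i - V (Suc i)) * \<phi> (t i - 1))
        \<le> V N * ((1 + e) * (\<Psi> s / s) + e * \<phi> (t M - 1))"
      by (simp add: algebra_simps)
    also have "\<dots> \<le> V N * (e * \<phi> (s - 1) + (1 + e) * (\<Psi> s / s))"
      using V[of N] e \<phi>(2)[of s "t M"] st by (intro mult_left_mono) (auto intro: mult_left_mono)
    finally show ?thesis .
  qed
  then show ?thesis using base by (simp add: t_def)
qed

subsection \<open>The main induction\<close>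

lemma ratio_shift:
  fixes p :: nat
  assumes "2 \<le> p" "D > 0"
  shows "ln (D / real p) / ln (real p) = ln D / ln (real p) - 1"
  using assms by (simp add: ln_div diff_divide_distrib)

lemma euler_prod_pos:
  assumes "\<And>p. p \<in> S \<Longrightarrow> g p < 1"
  shows "euler_prod S g n > 0"
  unfolding euler_prod_def using assms by (intro prod_pos) auto

lemma euler_prod_ratio:
  assumes g: "\<And>p. p \<in> S \<Longrightarrow> g p < 1" and e: "0 \<le> e"
    and dens: "\<And>u z. 1 < u \<Longrightarrow> u < z \<Longrightarrow>
      (\<Prod>p\<in>{p \<in> S. u \<le> real p \<and> real p < z}. inverse (1 - g p)) \<le> (1 + e) * (ln z / ln u)"
    and "1 < u" "u \<le> z"
  shows "euler_prod S g (nat \<lceil>u\<rceil>) \<le> (1 + e) * (ln z / ln u) * euler_prod S g (nat \<lceil>z\<rceil>)"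
proof (cases "u = z")
  case True
  have "1 * euler_prod S g (nat \<lceil>u\<rceil>) \<le> (1 + e) * euler_prod S g (nat \<lceil>u\<rceil>)"
    using e euler_prod_pos[of S g "nat \<lceil>u\<rceil>", OF g] by (intro mult_right_mono) auto
  then show ?thesis using True assms by simp
next
  case False
  define M where "M = {p \<in> S. u \<le> real p \<and> real p < z}"
  define R where "R = (\<Prod>p\<in>M. 1 - g p)"
  have "S \<inter> {..<nat \<lceil>z\<rceil>} = (S \<inter> {..<nat \<lceil>u\<rceil>}) \<union> M" "(S \<inter> {..<nat \<lceil>u\<rceil>}) \<inter> M = {}"
    using assms by (auto simp: M_def less_nat_ceiling_iff)
  moreover from this have "finite M" by (metis finite_Int finite_Un finite_lessThan)
  ultimately have V: "euler_prod S g (nat \<lceil>z\<rceil>) = euler_prod S g (nat \<lceil>u\<rceil>) * R"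
    by (simp add: euler_prod_def R_def prod.union_disjoint)
  have R: "R > 0" unfolding R_def using g by (intro prod_pos) (auto simp: M_def)
  have "inverse R \<le> (1 + e) * (ln z / ln u)"
    using dens[of u z] assms False by (simp add: R_def M_def prod_inversef[symmetric] o_def)
  then have "inverse R * (euler_prod S g (nat \<lceil>u\<rceil>) * R)
      \<le> (1 + e) * (ln z / ln u) * (euler_prod S g (nat \<lceil>u\<rceil>) * R)"
    using R euler_prod_pos[of S g "nat \<lceil>u\<rceil>", OF g] by (intro mult_right_mono) auto
  moreover have "inverse R * (euler_prod S g (nat \<lceil>u\<rceil>) * R) = euler_prod S g (nat \<lceil>u\<rceil>)"
    using R by simp
  ultimately show ?thesis unfolding V by simp
qed

context linear_sieve begin

text \<open>Induction on a bound for the sifting range: a prime below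
  \<open>nat \<lceil>z\<rceil> \<le> Suc m\<close> is at most \<open>m\<close>. The lower bound uses
  the induction hypothesis for the upper one; the upper bound then uses the lower bound just
  obtained. The level conditions are inherited, as p \<le> z and z^2 \<le> D give p \<le> D/p, while
  p^3 < D gives p^2 \<le> D/p.\<close>

lemma sieve_sum_bounds:
  fixes S :: "nat set" and g :: "nat \<Rightarrow> real" and e :: real
  assumes S: "\<And>p. p \<in> S \<Longrightarrow> 2 \<le> p"
    and g: "\<And>p. p \<in> S \<Longrightarrow> 0 \<le> g p" "\<And>p. p \<in> S \<Longrightarrow> g p < 1"
    and e: "0 \<le> e" "e \<le> 1 / 200"
    and dens: "\<And>u z. 1 < u \<Longrightarrow> u < z \<Longrightarrow>
      (\<Prod>p\<in>{p \<in> S. u \<le> real p \<and> real p < z}. inverse (1 - g p)) \<le> (1 + e) * (ln z / ln u)"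
  defines "V \<equiv> euler_prod S g"
  shows "(\<forall>z D. 1 < z \<and> nat \<lceil>z\<rceil> \<le> m \<and> z \<le> D \<longrightarrow>
      sieve_sum S g True (nat \<lceil>z\<rceil>) D
        \<le> V (nat \<lceil>z\<rceil>) * (1 + odd_sum (Suc m) (ln D / ln z) + e * (161 * hnorm (ln D / ln z)))) \<and>
    (\<forall>z D. 1 < z \<and> nat \<lceil>z\<rceil> \<le> m \<and> z\<^sup>2 \<le> D \<longrightarrow>
      V (nat \<lceil>z\<rceil>) * (1 - even_sum m (ln D / ln z) - e * (161 * hnorm (ln D / ln z)))
        \<le> sieve_sum S g False (nat \<lceil>z\<rceil>) D)"
proof (induction m)
  case 0
  show ?case by auto
next
  case (Suc m)
  have Vpos: "V n > 0" for n unfolding V_def by (rule euler_prod_pos) (rule g)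
  have ratio: "V (nat \<lceil>u\<rceil>) \<le> (1 + e) * (ln z / ln u) * V (nat \<lceil>z\<rceil>)" if "1 < u" "u \<le> z" for u z
    unfolding V_def using that by (intro euler_prod_ratio g e dens) auto
  have ratio': "V i \<le> (1 + e) * (ln z / ln (real i)) * V (nat \<lceil>z\<rceil>)" if "2 \<le> i" "real i < z" for i z
    using ratio[of "real i" z] that by simp
  have lower: "V (nat \<lceil>z\<rceil>) * (1 - even_sum (Suc m) (ln D / ln z) - e * (161 * hnorm (ln D / ln z)))
      \<le> sieve_sum S g False (nat \<lceil>z\<rceil>) D"
    if z: "1 < z" "nat \<lceil>z\<rceil> \<le> Suc m" "z\<^sup>2 \<le> D" for z D
  proof -
    let ?N = "nat \<lceil>z\<rceil>"
    define s where "s = ln D / ln z"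
    define \<phi> where "\<phi> = (\<lambda>x. odd_sum (Suc m) x + e * (161 * hnorm x))"
    define \<Psi> where "\<Psi> = (\<lambda>x. x * even_sum (Suc m) x + e * (161 * hnorm_tail x))"
    have "1 < z\<^sup>2" using z by (intro one_less_power) auto
    then have D: "1 < D" using z by linarith
    have "ln (z\<^sup>2) \<le> ln D" using z D by (subst ln_le_cancel_iff) auto
    then have s: "2 \<le> s" using z by (simp add: s_def pos_le_divide_eq ln_realpow)
    have "V ?N - sieve_sum S g False ?N D = (\<Sum>p\<in>S \<inter> {..<?N}. g p * (sieve_sum S g True p (D / real p) - V p))"
    proof -
      have "{p \<in> S. p < ?N \<and> (False \<longrightarrow> real p ^ 3 < D)} = S \<inter> {..<?N}" by auto
      then show ?thesis
        unfolding V_def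
        by (subst euler_prod_telescope, subst sieve_sum_expand)
          (simp add: right_diff_distrib sum_subtractf)
    qed
    also have "\<dots> \<le> (\<Sum>p\<in>S \<inter> {..<?N}. g p * V p * \<phi> (ln D / ln (real p) - 1))"
    proof (rule sum_mono)
      fix p assume p: "p \<in> S \<inter> {..<?N}"
      then have pz: "2 \<le> p" "real p < z" "p \<le> m" using S z by (auto simp: less_nat_ceiling_iff)
      have "real p * real p \<le> z * z" using pz by (intro mult_mono) auto
      then have "real p \<le> D / real p" using pz z by (simp add: pos_le_divide_eq power2_eq_square)
      then have "sieve_sum S g True (nat \<lceil>real p\<rceil>) (D / real p)
          \<le> V (nat \<lceil>real p\<rceil>) * (1 + odd_sum (Suc m) (ln (D / real p) / ln (real p))
            + e * (161 * hnorm (ln (D / real p) / ln (real p))))"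
        using pz by (intro Suc[THEN conjunct1, rule_format]) auto
      then have "sieve_sum S g True p (D / real p) \<le> V p * (1 + \<phi> (ln D / ln (real p) - 1))"
        using pz D ratio_shift[of p D] by (simp add: \<phi>_def add.assoc)
      then have "g p * (sieve_sum S g True p (D / real p) - V p)
          \<le> g p * (V p * \<phi> (ln D / ln (real p) - 1))"
        using g p by (intro mult_left_mono) (auto simp: distrib_left)
      then show "g p * (sieve_sum S g True p (D / real p) - V p)
          \<le> g p * V p * \<phi> (ln D / ln (real p) - 1)"
        by (simp add: mult.assoc)
    qed
    also have "\<dots> \<le> V ?N * (e * \<phi> (s - 1) + (1 + e) * (\<Psi> s / s))"
      unfolding V_def s_def
    proof (rule partial_summation)
      fix x assume x: "ln D / ln z \<le> x"
      show "0 \<le> \<phi> (x - 1)"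
        using odd_sum_nonneg[of "x - 1" "Suc m"] hnorm_pos[of "x - 1"] x s e by (simp add: \<phi>_def s_def)
      show "0 \<le> \<Psi> x"
        using even_sum_nonneg[of x "Suc m"] hnorm_tail_nonneg[of x] x s e by (simp add: \<Psi>_def s_def)
      fix y assume y: "x \<le> y"
      show "\<phi> (y - 1) \<le> \<phi> (x - 1)"
        unfolding \<phi>_def using x y s e
        by (intro add_mono mult_left_mono odd_sum_antimono hnorm_antimono) (auto simp: s_def)
      have "e * (161 * (hnorm (y - 1) * (y - x))) \<le> e * (161 * (hnorm_tail x - hnorm_tail y))"
        using x y s e by (intro mult_left_mono hnorm_tail_drop) (auto simp: s_def)
      then show "\<phi> (y - 1) * (y - x) \<le> \<Psi> x - \<Psi> y"
        using even_sum_drop[of x y "Suc m"] x y s by (simp add: \<phi>_def \<Psi>_def s_def algebra_simps)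
    qed (use S z D e ratio' Vpos in \<open>auto simp: V_def less_imp_le\<close>)
    also have "\<dots> \<le> V ?N * (even_sum (Suc m) s + e * (161 * hnorm s))"
    proof (rule mult_left_mono)
      have "\<Psi> s / s = even_sum (Suc m) s + e * (161 * (hnorm_tail s / s))"
        using s by (simp add: \<Psi>_def add_divide_distrib)
      \<comment> \<open>What is multiplied by \<open>e\<close> after \<open>even_sum\<close> is
        split off is exactly the left side of \<open>even_step\<close>.\<close>
      then have "e * \<phi> (s - 1) + (1 + e) * (\<Psi> s / s) = even_sum (Suc m) s +
          e * (odd_sum (Suc m) (s - 1) + even_sum (Suc m) s + 161 * (e * hnorm (s - 1) + (1 + e) * (hnorm_tail s / s)))"
        by (simp add: \<phi>_def algebra_simps)
      also have "\<dots> \<le> even_sum (Suc m) s + e * (161 * hnorm s)"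
        using even_step[OF s e, of "Suc m"] e by (intro add_left_mono mult_left_mono) auto
      finally show "e * \<phi> (s - 1) + (1 + e) * (\<Psi> s / s) \<le> even_sum (Suc m) s + e * (161 * hnorm s)" .
    qed (use Vpos in \<open>auto simp: less_imp_le\<close>)
    finally show ?thesis by (simp add: s_def algebra_simps)
  qed
  have upper3: "sieve_sum S g True (nat \<lceil>z\<rceil>) D
      \<le> V (nat \<lceil>z\<rceil>) * (1 + odd_sum (Suc (Suc m)) (ln D / ln z) + e * (283 / 2 * hnorm (ln D / ln z)))"
    if z: "1 < z" "nat \<lceil>z\<rceil> \<le> Suc m" "z ^ 3 \<le> D" for z D
  proof -
    let ?N = "nat \<lceil>z\<rceil>" and ?k = "Suc m"
    define s where "s = ln D / ln z"
    define \<phi> where "\<phi> = (\<lambda>x. even_sum ?k x + e * (161 * hnorm x))"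
    define \<Psi> where "\<Psi> = (\<lambda>x. x * odd_sum (Suc ?k) x + e * (161 * hnorm_tail x))"
    have "1 < z ^ 3" using z by (intro one_less_power) auto
    then have D: "1 < D" using z by linarith
    have "ln (z ^ 3) \<le> ln D" using z D by (subst ln_le_cancel_iff) auto
    then have s: "3 \<le> s" using z by (simp add: s_def pos_le_divide_eq ln_realpow)
    have cube: "real p ^ 3 < D" if "p < ?N" for p
    proof -
      have "real p ^ 3 < z ^ 3" using that by (intro power_strict_mono) (auto simp: less_nat_ceiling_iff)
      then show ?thesis using z by simp
    qed
    have "sieve_sum S g True ?N D - V ?N = (\<Sum>p\<in>S \<inter> {..<?N}. g p * (V p - sieve_sum S g False p (D / real p)))"
    proof -
      have "{p \<in> S. p < ?N \<and> (True \<longrightarrow> real p ^ 3 < D)} = S \<inter> {..<?N}" using cube by auto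
      then show ?thesis
        unfolding V_def
        by (subst euler_prod_telescope, subst sieve_sum_expand)
          (simp add: right_diff_distrib sum_subtractf)
    qed
    also have "\<dots> \<le> (\<Sum>p\<in>S \<inter> {..<?N}. g p * V p * \<phi> (ln D / ln (real p) - 1))"
    proof (rule sum_mono)
      fix p assume p: "p \<in> S \<inter> {..<?N}"
      then have pz: "2 \<le> p" "real p < z" "p \<le> m" "real p ^ 3 < D"
        using S z cube by (auto simp: less_nat_ceiling_iff)
      then have p2: "(real p)\<^sup>2 \<le> D / real p" by (simp add: pos_le_divide_eq power3_eq_cube power2_eq_square)
      have "V (nat \<lceil>real p\<rceil>) * (1 - even_sum ?k (ln (D / real p) / ln (real p))
            - e * (161 * hnorm (ln (D / real p) / ln (real p))))
          \<le> sieve_sum S g False (nat \<lceil>real p\<rceil>) (D / real p)"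
        using pz p2 by (intro lower) auto
      then have "V p - sieve_sum S g False p (D / real p) \<le> V p * \<phi> (ln D / ln (real p) - 1)"
        using pz D ratio_shift[of p D] by (simp add: \<phi>_def algebra_simps)
      then have "g p * (V p - sieve_sum S g False p (D / real p))
          \<le> g p * (V p * \<phi> (ln D / ln (real p) - 1))"
        using g p by (intro mult_left_mono) auto
      then show "g p * (V p - sieve_sum S g False p (D / real p))
          \<le> g p * V p * \<phi> (ln D / ln (real p) - 1)"
        by (simp add: mult.assoc)
    qed
    also have "\<dots> \<le> V ?N * (e * \<phi> (s - 1) + (1 + e) * (\<Psi> s / s))"
      unfolding V_def s_def
    proof (rule partial_summation)
      fix x assume x: "ln D / ln z \<le> x"
      show "0 \<le> \<phi> (x - 1)"
        using even_sum_nonneg[of "x - 1" ?k] hnorm_pos[of "x - 1"] x s e by (simp add: \<phi>_def s_def)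
      show "0 \<le> \<Psi> x"
        using odd_sum_nonneg[of x "Suc ?k"] hnorm_tail_nonneg[of x] x s e by (simp add: \<Psi>_def s_def)
      fix y assume y: "x \<le> y"
      show "\<phi> (y - 1) \<le> \<phi> (x - 1)"
        unfolding \<phi>_def using x y s e
        by (intro add_mono mult_left_mono even_sum_antimono hnorm_antimono) (auto simp: s_def)
      have "e * (161 * (hnorm (y - 1) * (y - x))) \<le> e * (161 * (hnorm_tail x - hnorm_tail y))"
        using x y s e by (intro mult_left_mono hnorm_tail_drop) (auto simp: s_def)
      then show "\<phi> (y - 1) * (y - x) \<le> \<Psi> x - \<Psi> y"
        using odd_sum_drop[of x y ?k] x y s by (simp add: \<phi>_def \<Psi>_def s_def algebra_simps)
    qed (use S z D e ratio' Vpos in \<open>auto simp: V_def less_imp_le\<close>)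
    also have "\<dots> \<le> V ?N * (odd_sum (Suc ?k) s + e * (283 / 2 * hnorm s))"
    proof (rule mult_left_mono)
      have "\<Psi> s / s = odd_sum (Suc ?k) s + e * (161 * (hnorm_tail s / s))"
        using s by (simp add: \<Psi>_def add_divide_distrib)
      then have "e * \<phi> (s - 1) + (1 + e) * (\<Psi> s / s) = odd_sum (Suc ?k) s +
          e * (even_sum ?k (s - 1) + odd_sum (Suc ?k) s + 161 * (e * hnorm (s - 1) + (1 + e) * (hnorm_tail s / s)))"
        by (simp add: \<phi>_def algebra_simps)
      also have "\<dots> \<le> odd_sum (Suc ?k) s + e * (283 / 2 * hnorm s)"
        using odd_step[OF s e, of ?k "Suc ?k"] e by (intro add_left_mono mult_left_mono) auto
      finally show "e * \<phi> (s - 1) + (1 + e) * (\<Psi> s / s) \<le> odd_sum (Suc ?k) s + e * (283 / 2 * hnorm s)" .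
    qed (use Vpos in \<open>auto simp: less_imp_le\<close>)
    finally show ?thesis by (simp add: s_def algebra_simps)
  qed
  have upper: "sieve_sum S g True (nat \<lceil>z\<rceil>) D
      \<le> V (nat \<lceil>z\<rceil>) * (1 + odd_sum (Suc (Suc m)) (ln D / ln z) + e * (161 * hnorm (ln D / ln z)))"
    if z: "1 < z" "nat \<lceil>z\<rceil> \<le> Suc m" "z \<le> D" for z D
  proof -
    let ?k = "Suc m"
    define s where "s = ln D / ln z"
    have s1: "1 \<le> s" using z by (simp add: s_def pos_le_divide_eq)
    show ?thesis
    proof (cases "z ^ 3 \<le> D")
      case True
      have "e * (283 / 2 * hnorm s) \<le> e * (161 * hnorm s)"
        using e hnorm_pos[OF s1] by (intro mult_left_mono) auto
      then have "V (nat \<lceil>z\<rceil>) * (1 + odd_sum (Suc ?k) s + e * (283 / 2 * hnorm s))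
          \<le> V (nat \<lceil>z\<rceil>) * (1 + odd_sum (Suc ?k) s + e * (161 * hnorm s))"
        using Vpos[of "nat \<lceil>z\<rceil>"] by (intro mult_left_mono) auto
      then show ?thesis using upper3[OF z(1,2) True] by (simp add: s_def)
    next
      case False
      \<comment> \<open>The upper sieve uses no prime p with p^3 \<ge> D, so its sum at
        \<open>z\<close> equals the one at this \<open>w\<close>, where the ratio of logarithms is
        3; the density hypothesis then transports the Euler product from \<open>w\<close> to
        \<open>z\<close>.\<close>
      define w where "w = root 3 D"
      have D: "1 < D" using z by simp
      have w: "1 < w" "w ^ 3 = D" using D by (simp_all add: w_def)
      have wz: "w \<le> z"
      proof (rule ccontr)
        assume "\<not> w \<le> z"
        then have "z ^ 3 \<le> w ^ 3" using z by (intro power_mono) auto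
        then show False using False w by simp
      qed
      have "ln D = 3 * ln w" using w ln_realpow[of w 3] by simp
      then have lnw: "ln D / ln w = 3" "ln z / ln w = 3 / s"
        using w z by (auto simp: s_def)
      have s3: "s \<le> 3"
      proof -
        have "ln w \<le> ln z" using w wz by (subst ln_le_cancel_iff) auto
        then show ?thesis using z \<open>ln D = 3 * ln w\<close> by (simp add: s_def pos_divide_le_eq)
      qed
      have cw: "real p < w \<longleftrightarrow> real p ^ 3 < D" for p
        using w power_strict_mono[of "real p" w 3] power_mono[of w "real p" 3] by fastforce
      have "{p \<in> S. p < nat \<lceil>z\<rceil> \<and> (True \<longrightarrow> real p ^ 3 < D)} =
          {p \<in> S. p < nat \<lceil>w\<rceil> \<and> (True \<longrightarrow> real p ^ 3 < D)}"
        using wz by (auto simp: less_nat_ceiling_iff cw[symmetric])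
      then have "sieve_sum S g True (nat \<lceil>z\<rceil>) D = sieve_sum S g True (nat \<lceil>w\<rceil>) D"
        by (simp only: sieve_sum_expand[of S g True "nat \<lceil>z\<rceil>"] sieve_sum_expand[of S g True "nat \<lceil>w\<rceil>"])
      also have "\<dots> \<le> V (nat \<lceil>w\<rceil>) * (1 + odd_sum (Suc ?k) 3 + e * (283 / 2 * hnorm 3))"
      proof -
        have "nat \<lceil>w\<rceil> \<le> Suc m" using wz z(2) by linarith
        from upper3[OF w(1) this, of D] show ?thesis using w lnw by simp
      qed
      also have "\<dots> \<le> ((1 + e) * (3 / s) * V (nat \<lceil>z\<rceil>)) * (1 + odd_sum (Suc ?k) 3 + e * (283 / 2 * hnorm 3))"
        using ratio[of w z] w wz lnw e odd_sum_nonneg[of 3 "Suc ?k"] hnorm_pos[of 3]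
        by (intro mult_right_mono) auto
      also have "\<dots> = V (nat \<lceil>z\<rceil>) * ((1 + e) * (3 / s) * (1 + odd_sum (Suc ?k) 3 + e * (283 / 2 * hnorm 3)))"
        by simp
      also have "\<dots> \<le> V (nat \<lceil>z\<rceil>) * (1 + odd_sum (Suc ?k) s + e * (161 * hnorm s))"
        using small_step[OF s1 s3 e, of ?k] Vpos[of "nat \<lceil>z\<rceil>"] by (intro mult_left_mono) auto
      finally show ?thesis by (simp add: s_def)
    qed
  qed
  show ?case using lower upper by blast
qed

end

subsection \<open>From weights to the sifted sum\<close>

lemma infsum_finite_sum:
  fixes F :: "'i \<Rightarrow> 'a \<Rightarrow> real"
  assumes "finite I" "\<And>i. i \<in> I \<Longrightarrow> F i summable_on X"
  shows "(\<lambda>x. \<Sum>i\<in>I. F i x) summable_on X \<and>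
    infsum (\<lambda>x. \<Sum>i\<in>I. F i x) X = (\<Sum>i\<in>I. infsum (F i) X)"
  using assms by (induction I rule: finite_induct) (auto simp: infsum_add intro: summable_on_add)

lemma summable_on_mult_bounded:
  fixes a w :: "nat \<Rightarrow> real"
  assumes "a summable_on X" "\<And>x. x \<in> X \<Longrightarrow> 0 \<le> a x" "\<And>x. x \<in> X \<Longrightarrow> \<bar>w x\<bar> \<le> C"
  shows "(\<lambda>x. a x * w x) summable_on X"
proof -
  have "(\<lambda>x. norm (C * a x)) summable_on X"
    using assms(1) by (intro summable_on_iff_abs_summable_on_real[THEN iffD1] summable_on_cmult_right)
  moreover have "norm (a x * w x) \<le> norm (C * a x)" if "x \<in> X" for x
  proof -
    have "a x * \<bar>w x\<bar> \<le> a x * C" using assms(2,3) that by (intro mult_left_mono) auto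
    moreover have "C \<ge> 0" using assms(3)[OF that] by linarith
    ultimately show ?thesis using assms(2)[OF that] by (simp add: abs_mult mult.commute)
  qed
  ultimately have "(\<lambda>x. norm (a x * w x)) summable_on X"
    by (rule Infinite_Sum.abs_summable_on_comparison_test)
  then show ?thesis by (rule abs_summable_summable)
qed

context linear_sieve begin

text \<open>Summability has to come first, because a divergent \<open>infsum\<close> is 0 by
  convention. A finite subset of \<open>X\<close> lies in an initial segment of the enumeration
  since \<open>j \<le> h j\<close>, so bounded partial sums suffice.\<close>

lemma partial_sums_le_infsum:
  fixes h :: "nat \<Rightarrow> nat" and C s :: real
  assumes X: "X = range h" and h: "inj h" "\<And>j. j \<le> h j"
    and nonneg: "\<And>j. 0 \<le> f (h j) s" and bdd: "\<And>k. (\<Sum>j<k. f (h j) s) \<le> C"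
  shows "(\<Sum>j<k. f (h j) s) \<le> infsum (\<lambda>n. f n s) X"
proof -
  have sum: "(\<Sum>j<k. f (h j) s) = (\<Sum>n\<in>h ` {..<k}. f n s)" for k
    using h by (subst sum.reindex) (auto intro: inj_on_subset)
  have "(\<lambda>n. f n s) summable_on X"
  proof (rule nonneg_bdd_above_summable_on)
    show "bdd_above (sum (\<lambda>n. f n s) ` {F. F \<subseteq> X \<and> finite F})"
    proof (rule bdd_aboveI2[where M = C])
      fix F assume F: "F \<in> {F. F \<subseteq> X \<and> finite F}"
      then obtain m where m: "\<forall>n\<in>F. n < m" by (metis finite_nat_set_iff_bounded mem_Collect_eq)
      have "F \<subseteq> h ` {..<m}"
      proof
        fix n assume n: "n \<in> F"
        then obtain j where "n = h j" using F X by auto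
        then show "n \<in> h ` {..<m}" using m n h(2)[of j] by (auto intro!: imageI dest!: bspec)
      qed
      then have "(\<Sum>n\<in>F. f n s) \<le> (\<Sum>n\<in>h ` {..<m}. f n s)"
        using nonneg by (intro sum_mono2) auto
      then show "(\<Sum>n\<in>F. f n s) \<le> C" using bdd[of m] sum[of m] by simp
    qed
  qed (use nonneg X in auto)
  then have "(\<Sum>n\<in>h ` {..<k}. f n s) \<le> infsum (\<lambda>n. f n s) X"
    using nonneg X by (intro finite_sum_le_infsum) auto
  then show ?thesis by (simp add: sum)
qed

lemma odd_sum_le_upper:
  assumes "1 \<le> s"
  shows "1 + odd_sum k s \<le> upper_sieve_fun f s"
proof -
  have "{n. 1 \<le> n \<and> odd n} = range (\<lambda>j. 2 * j + 1 :: nat)" by (auto elim!: oddE)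
  moreover have "(\<Sum>j<k. f (2 * j + 1) s) \<le> 365 / 100 - 1" for k
    using odd_sum_antimono[OF order_refl assms, of k] odd_sum_le[of 1 k] by (simp add: odd_sum_def)
  ultimately show ?thesis
    unfolding upper_sieve_fun_def odd_sum_def using f_nonneg assms
    by (intro add_left_mono partial_sums_le_infsum[where C = "365 / 100 - 1"]) (auto simp: inj_on_def)
qed

lemma lower_le_even_sum:
  assumes "2 \<le> s"
  shows "lower_sieve_fun f s \<le> 1 - even_sum k s"
proof -
  have "n \<in> range (\<lambda>j. 2 * j + 2 :: nat)" if "1 \<le> n" "even n" for n
  proof -
    obtain j where "n = 2 * j" using \<open>even n\<close> by (auto elim: evenE)
    then show ?thesis using that by (intro image_eqI[of _ _ "j - 1"]) auto
  qed
  then have "{n. 1 \<le> n \<and> even n} = range (\<lambda>j. 2 * j + 2 :: nat)" by auto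
  moreover have "(\<Sum>j<k. f (2 * j + 2) s) \<le> 1" for k
    using even_sum_antimono[OF order_refl assms, of k] even_sum_2_le[of k] by (simp add: even_sum_def)
  ultimately show ?thesis
    unfolding lower_sieve_fun_def even_sum_def using f_nonneg assms
    by (intro diff_left_mono partial_sums_le_infsum[where C = 1]) (auto simp: inj_on_def)
qed

end

text \<open>Primes in \<open>Q\<close> are sieved completely, which raises the level from \<open>D\<close> to \<open>\<Prod>Q * D\<close>.\<close>

definition full_family :: "nat set \<Rightarrow> nat set \<Rightarrow> bool \<Rightarrow> nat \<Rightarrow> real \<Rightarrow> nat set set" where
  "full_family P Q up n D =
     (\<lambda>(J, I). J \<union> I) ` (Pow (Q \<inter> {..<n}) \<times> sieve_family (P - Q) up n D)"

lemma full_familyE: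
  assumes "T \<in> full_family P Q up n D"
  obtains J I where "T = J \<union> I" "J \<subseteq> Q \<inter> {..<n}" "I \<in> sieve_family (P - Q) up n D"
    "I \<subseteq> (P - Q) \<inter> {..<n}" "finite J" "finite I"
proof -
  obtain J I where *: "T = J \<union> I" "J \<subseteq> Q \<inter> {..<n}" "I \<in> sieve_family (P - Q) up n D"
    using assms unfolding full_family_def by auto
  moreover have "I \<subseteq> (P - Q) \<inter> {..<n}" using *(3) by (rule sieve_family_sub)
  ultimately show ?thesis using that[of J I] finite_subset[of J "Q \<inter> {..<n}"]
      finite_subset[of I "(P - Q) \<inter> {..<n}"] by blast
qed

lemma finite_full_family: "finite (full_family P Q up n D)"
  unfolding full_family_def by (intro finite_imageI finite_cartesian_product finite_sieve_family) auto

lemma full_family_sum: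
  "euler_prod Q g n * sieve_sum (P - Q) g up n D
    = (\<Sum>T\<in>full_family P Q up n D. (- 1) ^ card T * (\<Prod>p\<in>T. g p))"
proof -
  let ?K = "Pow (Q \<inter> {..<n}) \<times> sieve_family (P - Q) up n D"
  have sub: "I \<inter> Q = {} \<and> finite I" if "I \<in> sieve_family (P - Q) up n D" for I
    using sieve_family_sub[OF that] by (auto intro: finite_subset)
  have inj: "inj_on (\<lambda>(J, I). J \<union> I) ?K"
  proof (rule inj_onI, clarify)
    fix J I J' I' assume *: "J \<subseteq> Q \<inter> {..<n}" "J' \<subseteq> Q \<inter> {..<n}"
      "I \<in> sieve_family (P - Q) up n D" "I' \<in> sieve_family (P - Q) up n D" "J \<union> I = J' \<union> I'"
    have "J = (J \<union> I) \<inter> Q" "J' = (J' \<union> I') \<inter> Q" "I = (J \<union> I) - Q" "I' = (J' \<union> I') - Q"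
      using * sub by auto
    then show "J = J' \<and> I = I'" using *(5) by metis
  qed
  have "(\<Sum>T\<in>full_family P Q up n D. (- 1) ^ card T * (\<Prod>p\<in>T. g p))
      = (\<Sum>(J, I)\<in>?K. ((- 1) ^ card J * (\<Prod>p\<in>J. g p)) * ((- 1) ^ card I * (\<Prod>p\<in>I. g p)))"
    unfolding full_family_def sum.reindex[OF inj] o_def
  proof (rule sum.cong[OF refl], clarify)
    fix J I assume *: "J \<subseteq> Q \<inter> {..<n}" "I \<in> sieve_family (P - Q) up n D"
    then have "finite J" "finite I" "J \<inter> I = {}" using sub by (auto intro: finite_subset)
    then show "(- 1) ^ card (J \<union> I) * (\<Prod>p\<in>J \<union> I. g p)
        = ((- 1) ^ card J * (\<Prod>p\<in>J. g p)) * ((- 1) ^ card I * (\<Prod>p\<in>I. g p))"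
      by (simp add: card_Un_disjoint prod.union_disjoint power_add)
  qed
  also have "\<dots> = (\<Sum>J\<in>Pow (Q \<inter> {..<n}). (- 1) ^ card J * (\<Prod>p\<in>J. g p)) * sieve_sum (P - Q) g up n D"
    by (simp add: sieve_sum_family sum_product sum.cartesian_product)
  also have "(\<Sum>J\<in>Pow (Q \<inter> {..<n}). (- 1) ^ card J * (\<Prod>p\<in>J. g p)) = euler_prod Q g n"
    by (simp add: euler_prod_def prod_diff_conv_sum)
  finally show ?thesis by simp
qed

section \<open>Squarefree numbers as finite sets of primes\<close>

lemma prime_dvd_prod_set:
  assumes "finite T" "\<And>p. p \<in> T \<Longrightarrow> prime p" "prime (q :: nat)"
  shows "q dvd \<Prod>T \<longleftrightarrow> q \<in> T"
proof
  assume "q dvd \<Prod>T"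
  then obtain p where "p \<in> T" "q dvd p" using assms by (auto simp: prime_dvd_prod_iff)
  then show "q \<in> T" using assms primes_dvd_imp_eq by metis
qed (use assms in \<open>auto intro: dvd_prodI\<close>)

lemma prod_dvd_iff:
  assumes "finite T" "\<And>p. p \<in> T \<Longrightarrow> prime (p :: nat)"
  shows "\<Prod>T dvd m \<longleftrightarrow> (\<forall>p\<in>T. p dvd m)"
  using assms
proof (induction T rule: finite_induct)
  case (insert q T)
  have "coprime q (\<Prod>T)"
    using insert by (simp add: prime_imp_coprime prime_dvd_prod_set)
  then show ?case using insert by (auto intro: divides_mult dest: dvd_mult_left dvd_mult_right)
qed simp

lemma multiplicative_prod:
  assumes "multiplicative_fun g" "finite T" "\<And>p. p \<in> T \<Longrightarrow> prime p"
  shows "g (\<Prod>T) = (\<Prod>p\<in>T. g p)"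
  using assms(2,3)
proof (induction T rule: finite_induct)
  case empty then show ?case using assms(1) by (simp add: multiplicative_fun_def)
next
  case (insert q T)
  have "coprime q (\<Prod>T)"
    using insert by (simp add: prime_imp_coprime prime_dvd_prod_set)
  moreover have "q \<ge> 1" "\<Prod>T \<ge> 1"
    using insert by (auto simp: prime_ge_1_nat Suc_le_eq prod_pos prime_gt_0_nat)
  ultimately show ?case using assms(1) insert by (simp add: multiplicative_fun_def)
qed

lemma sieve_density_eq:
  assumes "\<forall>p\<in>P. prime p"
  shows "sieve_density g P z = euler_prod P g (nat \<lceil>z\<rceil>)"
proof -
  have eq: "{p \<in> P. real p < z} = P \<inter> {..<nat \<lceil>z\<rceil>}" by (auto simp: less_nat_ceiling_iff)
  have "{p. prime p \<and> p dvd sieve_prod P z} = P \<inter> {..<nat \<lceil>z\<rceil>}"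
    unfolding sieve_prod_def eq using assms prime_dvd_prod_set[of "P \<inter> {..<nat \<lceil>z\<rceil>}"] by auto
  then show ?thesis by (simp add: sieve_density_def euler_prod_def)
qed

text \<open>The sifting condition becomes an Euler product for the 0/1-valued function testing
  \<open>p dvd m\<close>, so the same sieve sums apply to it and to the densities.\<close>

lemma coprime_sieve_prod:
  assumes "\<forall>p\<in>P. prime p"
  shows "euler_prod P (\<lambda>p. if p dvd m then 1 else 0) (nat \<lceil>z\<rceil>)
    = (if coprime m (sieve_prod P z) then 1 else 0)"
proof -
  have eq: "{p \<in> P. real p < z} = P \<inter> {..<nat \<lceil>z\<rceil>}" by (auto simp: less_nat_ceiling_iff)
  have fin: "finite (P \<inter> {..<nat \<lceil>z\<rceil>})" by simp
  have "coprime m (sieve_prod P z) \<longleftrightarrow> (\<forall>p\<in>P \<inter> {..<nat \<lceil>z\<rceil>}. \<not> p dvd m)"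
  proof
    assume c: "coprime m (sieve_prod P z)"
    show "\<forall>p\<in>P \<inter> {..<nat \<lceil>z\<rceil>}. \<not> p dvd m"
    proof (intro ballI notI)
      fix p assume p: "p \<in> P \<inter> {..<nat \<lceil>z\<rceil>}" "p dvd m"
      then have "p dvd sieve_prod P z" unfolding sieve_prod_def eq using fin by (intro dvd_prodI) auto
      then have "is_unit p" using c p by (meson coprime_common_divisor)
      then show False using assms p by auto
    qed
  next
    assume "\<forall>p\<in>P \<inter> {..<nat \<lceil>z\<rceil>}. \<not> p dvd m"
    then show "coprime m (sieve_prod P z)"
      unfolding sieve_prod_def eq using assms
      by (intro prod_coprime_right) (auto simp: coprime_commute prime_imp_coprime)
  qed
  then show ?thesis using fin by (auto simp: euler_prod_def prod_zero_iff intro!: prod.neutral)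
qed

lemma euler_prod_split:
  assumes "Q \<subseteq> P"
  shows "euler_prod P g n = euler_prod Q g n * euler_prod (P - Q) g n"
proof -
  have "P \<inter> {..<n} = (Q \<inter> {..<n}) \<union> ((P - Q) \<inter> {..<n})" using assms by auto
  then show ?thesis
    unfolding euler_prod_def by (simp only:) (intro prod.union_disjoint, auto)
qed

lemma full_family_prime:
  assumes "T \<in> full_family P Q up n D" "\<forall>p\<in>P. prime p" "Q \<subseteq> P"
  shows "finite T" "\<And>p. p \<in> T \<Longrightarrow> prime p" "T \<subseteq> P \<inter> {..<n}"
  using assms(1) by (rule full_familyE, use assms in auto)+

lemma full_family_prod_less:
  assumes T: "T \<in> full_family P Q up n D" and P: "\<forall>p\<in>P. prime p" and Q: "Q \<subseteq> P" "finite Q"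
    and D: "D > 1" "\<not> up \<Longrightarrow> \<forall>p\<in>P. p < n \<longrightarrow> (real p)\<^sup>2 < D"
  shows "real (\<Prod>T) < real (\<Prod>Q) * D"
proof -
  obtain J I where J: "T = J \<union> I" "J \<subseteq> Q \<inter> {..<n}" "I \<in> sieve_family (P - Q) up n D"
    "I \<subseteq> (P - Q) \<inter> {..<n}" "finite J" "finite I"
    using T by (rule full_familyE)
  have Qpos: "\<Prod>Q > 0" using P Q by (intro prod_pos) (auto simp: prime_gt_0_nat)
  have "\<Prod>J dvd \<Prod>Q" using J Q by (intro prod_dvd_prod_subset) auto
  then have JQ: "\<Prod>J \<le> \<Prod>Q" using Qpos by (rule dvd_imp_le)
  have ID: "real (\<Prod>I) < D"
  proof (rule sieve_family_prod_less[OF J(3) D(1)])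
    show "2 \<le> p" if "p \<in> P - Q" for p using that P by (auto intro: prime_ge_2_nat)
    show "\<forall>p\<in>P - Q. p < n \<longrightarrow> (real p)\<^sup>2 < D" if "\<not> up" using D(2)[OF that] by blast
  qed
  have "\<Prod>T = \<Prod>J * \<Prod>I" unfolding J(1) using J by (intro prod.union_disjoint) auto
  also have "\<dots> \<le> \<Prod>Q * \<Prod>I" using JQ by (rule mult_le_mono1)
  finally have "real (\<Prod>T) \<le> real (\<Prod>Q * \<Prod>I)" by (rule of_nat_mono)
  also have "\<dots> = real (\<Prod>Q) * real (\<Prod>I)" by (rule of_nat_mult)
  also have "\<dots> < real (\<Prod>Q) * D"
    using ID Qpos by (intro mult_strict_left_mono) (simp_all only: of_nat_0_less_iff)
  finally show ?thesis .
qed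

text \<open>A set of primes is determined by its product, so each divisor of P(z) below the level is
  counted at most once.\<close>

lemma sum_remainder_le:
  fixes z :: real
  assumes P: "\<forall>p\<in>P. prime p" and Q: "Q \<subseteq> P" "finite Q"
    and D: "D > 1" "\<not> up \<Longrightarrow> \<forall>p\<in>P. p < nat \<lceil>z\<rceil> \<longrightarrow> (real p)\<^sup>2 < D"
  shows "\<bar>\<Sum>T\<in>full_family P Q up (nat \<lceil>z\<rceil>) D. (- 1) ^ card T * sieve_remainder a g (\<Prod>T)\<bar>
    \<le> sieve_error a g P Q z D"
proof -
  let ?F = "full_family P Q up (nat \<lceil>z\<rceil>) D"
  let ?E = "{d. d dvd sieve_prod P z \<and> real d < real (\<Prod>Q) * D}"
  note prime = full_family_prime[OF _ P Q(1)]
  have eq: "{p \<in> P. real p < z} = P \<inter> {..<nat \<lceil>z\<rceil>}" by (auto simp: less_nat_ceiling_iff)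
  have "sieve_prod P z > 0"
    unfolding sieve_prod_def eq using P by (intro prod_pos) (auto simp: prime_gt_0_nat)
  then have fin: "finite ?E" by auto
  have inj: "inj_on Prod ?F"
  proof (rule inj_onI)
    fix T T' assume T: "T \<in> ?F" "T' \<in> ?F" "\<Prod>T = \<Prod>T'"
    have *: "p \<in> T'' \<longleftrightarrow> prime p \<and> p dvd \<Prod>T''" if "T'' \<in> ?F" for p T''
      using prime_dvd_prod_set[OF prime(1,2)[OF that], of p] prime(2)[OF that, of p] by blast
    show "T = T'" using *[OF T(1)] *[OF T(2)] unfolding T(3) by blast
  qed
  have sub: "Prod ` ?F \<subseteq> ?E"
  proof clarify
    fix T assume T: "T \<in> ?F"
    have "\<Prod>T dvd sieve_prod P z"
      unfolding sieve_prod_def eq using prime(3)[OF T] by (intro prod_dvd_prod_subset) auto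
    then show "\<Prod>T dvd sieve_prod P z \<and> real (\<Prod>T) < real (\<Prod>Q) * D"
      using full_family_prod_less[OF T P Q D] by blast
  qed
  have "\<bar>\<Sum>T\<in>?F. (- 1) ^ card T * sieve_remainder a g (\<Prod>T)\<bar>
      \<le> (\<Sum>T\<in>?F. \<bar>sieve_remainder a g (\<Prod>T)\<bar>)"
    by (rule order_trans[OF sum_abs]) (simp add: abs_mult power_abs)
  also have "\<dots> = (\<Sum>d\<in>Prod ` ?F. \<bar>sieve_remainder a g d\<bar>)"
    by (subst sum.reindex[OF inj]) simp
  also have "\<dots> \<le> sieve_error a g P Q z D"
    unfolding sieve_error_def by (intro sum_mono2 fin sub) auto
  finally show ?thesis .
qed

section \<open>Averaging the sieve inequalities over n with weights a(n)\<close>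

locale sifted_weights =
  fixes a :: "nat \<Rightarrow> real" and g :: "nat \<Rightarrow> nat \<Rightarrow> real" and P Q :: "nat set"
  assumes a_nonneg: "\<And>n. 1 \<le> n \<Longrightarrow> 0 \<le> a n" and a_summable: "a summable_on {1..}"
    and P_primes: "\<forall>p\<in>P. prime p" and g_mult: "\<And>n. 1 \<le> n \<Longrightarrow> multiplicative_fun (g n)"
    and g_range: "\<And>n p. 1 \<le> n \<Longrightarrow> p \<in> P \<Longrightarrow> 0 \<le> g n p \<and> g n p < 1"
    and Q_sub: "Q \<subseteq> P" and Q_finite: "finite Q"
begin

lemma summable_weight:
  assumes "\<And>n. 1 \<le> n \<Longrightarrow> \<bar>w n\<bar> \<le> 1"
  shows "(\<lambda>n. a n * w n) summable_on {1..}"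
  using assms a_nonneg by (intro summable_on_mult_bounded[OF a_summable]) auto

text \<open>\<open>W\<close> is a finite signed sum of products over sets \<open>T\<close>. For the
  divisibility indicator the sum over n gives the mass on multiples of \<open>\<Prod>T\<close>, for
  \<open>g n\<close> the expected value of that mass, and the two differ by the remainder.\<close>

lemma sieve_identity:
  fixes up and z D :: real
  defines "N \<equiv> nat \<lceil>z\<rceil>"
  defines "W \<equiv> \<lambda>h. euler_prod Q h N * sieve_sum (P - Q) h up N D"
  shows "(\<lambda>n. a n * W (\<lambda>p. if p dvd n then 1 else 0)) summable_on {1..}"
    and "(\<lambda>n. a n * W (g n)) summable_on {1..}"
    and "(\<Sum>\<^sub>\<infinity>n\<in>{1..}. a n * W (\<lambda>p. if p dvd n then 1 else 0)) =
      (\<Sum>\<^sub>\<infinity>n\<in>{1..}. a n * W (g n)) +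
      (\<Sum>T\<in>full_family P Q up N D. (- 1) ^ card T * sieve_remainder a g (\<Prod>T))"
proof -
  let ?F = "full_family P Q up N D"
  note prime = full_family_prime[OF _ P_primes Q_sub]
  define u where "u = (\<lambda>T n. (- 1) ^ card T * (a n * (if \<Prod>T dvd n then 1 else 0)))"
  define v where "v = (\<lambda>T n. (- 1) ^ card T * (a n * g n (\<Prod>T)))"
  have W: "W h = (\<Sum>T\<in>?F. (- 1) ^ card T * (\<Prod>p\<in>T. h p))" for h
    by (simp add: W_def full_family_sum)
  have u: "a n * W (\<lambda>p. if p dvd n then 1 else 0) = (\<Sum>T\<in>?F. u T n)" for n
    unfolding W u_def sum_distrib_left
  proof (rule sum.cong[OF refl])
    fix T assume T: "T \<in> ?F"
    have "(\<Prod>p\<in>T. if p dvd n then 1 else 0) = (if \<Prod>T dvd n then 1 else 0 :: real)"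
      using prime(1)[OF T] prod_dvd_iff[OF prime(1,2)[OF T], of n]
      by (auto simp: prod_zero_iff intro!: prod.neutral)
    then show "a n * ((- 1) ^ card T * (\<Prod>p\<in>T. if p dvd n then 1 else 0)) =
        (- 1) ^ card T * (a n * (if \<Prod>T dvd n then 1 else 0))"
      by (simp only: mult.left_commute)
  qed
  have v: "a n * W (g n) = (\<Sum>T\<in>?F. v T n)" if "1 \<le> n" for n
    unfolding W v_def sum_distrib_left
  proof (rule sum.cong[OF refl])
    fix T assume T: "T \<in> ?F"
    show "a n * ((- 1) ^ card T * (\<Prod>p\<in>T. g n p)) = (- 1) ^ card T * (a n * g n (\<Prod>T))"
      using multiplicative_prod[OF g_mult[OF that] prime(1,2)[OF T]] by simp
  qed
  have su: "u T summable_on {1..}" for T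
    unfolding u_def by (intro summable_on_cmult_right summable_weight) auto
  have sv: "v T summable_on {1..}" if T: "T \<in> ?F" for T
    unfolding v_def
  proof (intro summable_on_cmult_right summable_weight)
    fix n :: nat assume n: "1 \<le> n"
    have "0 \<le> g n p" "g n p \<le> 1" if "p \<in> T" for p
      using g_range[OF n, of p] prime(3)[OF T] that by auto
    then have "0 \<le> (\<Prod>p\<in>T. g n p)" "(\<Prod>p\<in>T. g n p) \<le> 1"
      by (auto intro!: prod_nonneg prod_le_1)
    then show "\<bar>g n (\<Prod>T)\<bar> \<le> 1"
      using multiplicative_prod[OF g_mult[OF n] prime(1,2)[OF T]] by simp
  qed
  have fin: "finite ?F" by (rule finite_full_family)
  note U = infsum_finite_sum[OF fin, of u, OF su] and V = infsum_finite_sum[OF fin, of v, OF sv]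
  show "(\<lambda>n. a n * W (\<lambda>p. if p dvd n then 1 else 0)) summable_on {1..}"
    using U unfolding u by blast
  have "(\<lambda>n. a n * W (g n)) summable_on {1..} \<longleftrightarrow> (\<lambda>n. \<Sum>T\<in>?F. v T n) summable_on {1..}"
    by (rule summable_on_cong) (use v in auto)
  then show "(\<lambda>n. a n * W (g n)) summable_on {1..}" using V by blast
  have "(\<Sum>\<^sub>\<infinity>n\<in>{1..}. a n * W (g n)) = (\<Sum>\<^sub>\<infinity>n\<in>{1..}. \<Sum>T\<in>?F. v T n)"
    by (rule infsum_cong) (use v in auto)
  also have "\<dots> = (\<Sum>T\<in>?F. (- 1) ^ card T * (\<Sum>\<^sub>\<infinity>n\<in>{1..}. a n * g n (\<Prod>T)))"
    using V by (simp add: v_def infsum_cmult_right')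
  finally have v': "(\<Sum>\<^sub>\<infinity>n\<in>{1..}. a n * W (g n)) =
      (\<Sum>T\<in>?F. (- 1) ^ card T * (\<Sum>\<^sub>\<infinity>n\<in>{1..}. a n * g n (\<Prod>T)))" .
  have "(\<Sum>\<^sub>\<infinity>n\<in>{1..}. a n * (if d dvd n then 1 else 0)) = (\<Sum>\<^sub>\<infinity>n\<in>{n. n \<ge> 1 \<and> d dvd n}. a n)" for d
    by (rule infsum_cong_neutral) auto
  then have "(\<Sum>\<^sub>\<infinity>n\<in>{1..}. a n * W (\<lambda>p. if p dvd n then 1 else 0)) =
      (\<Sum>T\<in>?F. (- 1) ^ card T * (\<Sum>\<^sub>\<infinity>n\<in>{n. n \<ge> 1 \<and> \<Prod>T dvd n}. a n))"
    using U unfolding u by (simp add: u_def infsum_cmult_right')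
  then show "(\<Sum>\<^sub>\<infinity>n\<in>{1..}. a n * W (\<lambda>p. if p dvd n then 1 else 0)) =
      (\<Sum>\<^sub>\<infinity>n\<in>{1..}. a n * W (g n)) +
      (\<Sum>T\<in>?F. (- 1) ^ card T * sieve_remainder a g (\<Prod>T))"
    unfolding v' by (simp add: sieve_remainder_def right_diff_distrib sum_subtractf)
qed

lemma density_bounds:
  assumes "1 \<le> n" "S \<subseteq> P"
  shows "0 < euler_prod S (g n) N" "euler_prod S (g n) N \<le> 1"
proof -
  have "0 \<le> g n p" "g n p < 1" if "p \<in> S" for p using g_range[OF assms(1), of p] assms that by auto
  then show "0 < euler_prod S (g n) N" "euler_prod S (g n) N \<le> 1"
    unfolding euler_prod_def by (auto intro!: prod_pos prod_le_1 simp: less_imp_le)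
qed

lemma main_term_summable: "(\<lambda>n. a n * sieve_density (g n) P z) summable_on {1..}"
proof (rule summable_weight)
  fix n :: nat assume "1 \<le> n"
  from density_bounds[OF this order_refl, of "nat \<lceil>z\<rceil>"]
  show "\<bar>sieve_density (g n) P z\<bar> \<le> 1" by (simp add: sieve_density_eq[OF P_primes])
qed

lemma main_term_pos:
  assumes "total_mass a > 0"
  shows "sieve_main_term a g P z > 0"
proof -
  have "\<exists>n\<ge>1. a n \<noteq> 0"
  proof (rule ccontr)
    assume "\<not> ?thesis"
    then have "total_mass a = 0" unfolding total_mass_def by (intro infsum_0) auto
    then show False using assms by simp
  qed
  then obtain n where n: "1 \<le> n" "a n > 0" using a_nonneg by (metis less_eq_real_def)
  have nonneg: "0 \<le> a m * sieve_density (g m) P z" if "1 \<le> m" for m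
    using a_nonneg[OF that] density_bounds(1)[OF that order_refl, of "nat \<lceil>z\<rceil>"]
    by (simp add: sieve_density_eq[OF P_primes] less_imp_le)
  have "0 < a n * sieve_density (g n) P z"
    using n density_bounds(1)[OF n(1) order_refl] by (simp add: sieve_density_eq[OF P_primes])
  also have "\<dots> = (\<Sum>m\<in>{n}. a m * sieve_density (g m) P z)" by simp
  also have "\<dots> \<le> sieve_main_term a g P z"
    unfolding sieve_main_term_def using n nonneg
    by (intro finite_sum_le_infsum main_term_summable) auto
  finally show ?thesis .
qed

lemma sifted_sum_eq:
  "sifted_sum a P z = (\<Sum>\<^sub>\<infinity>n\<in>{1..}. a n * euler_prod P (\<lambda>p. if p dvd n then 1 else 0) (nat \<lceil>z\<rceil>))"
  unfolding sifted_sum_def coprime_sieve_prod[OF P_primes] by (rule infsum_cong_neutral) auto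

lemma sifted_indicator_summable:
  fixes z :: real
  shows
  "(\<lambda>n. a n * euler_prod P (\<lambda>p. if p dvd n then 1 else 0) (nat \<lceil>z\<rceil>)) summable_on {1..}"
  unfolding coprime_sieve_prod[OF P_primes] by (rule summable_weight) auto

lemma indicator_nonneg: "0 \<le> euler_prod S (\<lambda>p. if p dvd n then 1 else 0) N"
  unfolding euler_prod_def by (intro prod_nonneg) auto

text \<open>The constant \<open>C\<close> must serve every n at once so that it can leave the sum
  over n; \<open>sieve_sum_bounds\<close> provides this, its constant depending on the density only
  through epsilon.\<close>

lemma upper_bound:
  assumes D: "1 < D"
    and C: "\<And>n. 1 \<le> n \<Longrightarrow> sieve_sum (P - Q) (g n) True (nat \<lceil>z\<rceil>) D
      \<le> euler_prod (P - Q) (g n) (nat \<lceil>z\<rceil>) * C"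
  shows "sifted_sum a P z \<le> C * sieve_main_term a g P z + sieve_error a g P Q z D"
proof -
  let ?N = "nat \<lceil>z\<rceil>"
  let ?W = "\<lambda>h. euler_prod Q h ?N * sieve_sum (P - Q) h True ?N D"
  let ?i = "\<lambda>n p. if p dvd n then 1 else 0 :: real"
  note id = sieve_identity[of z True D]
  have "sifted_sum a P z \<le> (\<Sum>\<^sub>\<infinity>n\<in>{1..}. a n * ?W (?i n))"
    unfolding sifted_sum_eq
  proof (rule infsum_mono[OF sifted_indicator_summable id(1)])
    fix n :: nat assume "n \<in> {1..}"
    then show "a n * euler_prod P (?i n) ?N \<le> a n * ?W (?i n)"
      unfolding euler_prod_split[OF Q_sub] using a_nonneg
      by (intro mult_left_mono sieve_sum_indicator[THEN conjunct1] indicator_nonneg) auto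
  qed
  also have "\<dots> \<le> (\<Sum>\<^sub>\<infinity>n\<in>{1..}. a n * ?W (g n)) + sieve_error a g P Q z D"
    unfolding id(3) using sum_remainder_le[OF P_primes Q_sub Q_finite D, of True z a g] by simp
  also have "(\<Sum>\<^sub>\<infinity>n\<in>{1..}. a n * ?W (g n)) \<le> (\<Sum>\<^sub>\<infinity>n\<in>{1..}. C * (a n * sieve_density (g n) P z))"
  proof (rule infsum_mono[OF id(2)])
    show "(\<lambda>n. C * (a n * sieve_density (g n) P z)) summable_on {1..}"
      by (intro summable_on_cmult_right main_term_summable)
    fix n :: nat assume n: "n \<in> {1..}"
    then have "a n * ?W (g n) \<le> a n * (euler_prod Q (g n) ?N * (euler_prod (P - Q) (g n) ?N * C))"
      using a_nonneg C density_bounds(1)[of n Q] Q_sub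
      by (intro mult_left_mono) (auto simp: less_imp_le)
    then show "a n * ?W (g n) \<le> C * (a n * sieve_density (g n) P z)"
      unfolding sieve_density_eq[OF P_primes] euler_prod_split[OF Q_sub] by (simp add: mult_ac)
  qed
  also have "\<dots> = C * sieve_main_term a g P z"
    by (simp add: sieve_main_term_def infsum_cmult_right')
  finally show ?thesis by simp
qed

lemma lower_bound:
  assumes D: "1 < D" and z: "0 \<le> z" "z\<^sup>2 \<le> D"
    and C: "\<And>n. 1 \<le> n \<Longrightarrow> euler_prod (P - Q) (g n) (nat \<lceil>z\<rceil>) * C
      \<le> sieve_sum (P - Q) (g n) False (nat \<lceil>z\<rceil>) D"
  shows "sifted_sum a P z \<ge> C * sieve_main_term a g P z - sieve_error a g P Q z D"
proof -
  let ?N = "nat \<lceil>z\<rceil>"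
  let ?W = "\<lambda>h. euler_prod Q h ?N * sieve_sum (P - Q) h False ?N D"
  let ?i = "\<lambda>n p. if p dvd n then 1 else 0 :: real"
  note id = sieve_identity[of z False D]
  have sq: "\<forall>p\<in>P. p < ?N \<longrightarrow> (real p)\<^sup>2 < D"
  proof (intro ballI impI)
    fix p assume "p < ?N"
    then have "(real p)\<^sup>2 < z\<^sup>2" by (intro power_strict_mono) (auto simp: less_nat_ceiling_iff)
    then show "(real p)\<^sup>2 < D" using z by simp
  qed
  have "C * sieve_main_term a g P z = (\<Sum>\<^sub>\<infinity>n\<in>{1..}. C * (a n * sieve_density (g n) P z))"
    by (simp add: sieve_main_term_def infsum_cmult_right')
  also have "\<dots> \<le> (\<Sum>\<^sub>\<infinity>n\<in>{1..}. a n * ?W (g n))"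
  proof (rule infsum_mono[OF _ id(2)])
    show "(\<lambda>n. C * (a n * sieve_density (g n) P z)) summable_on {1..}"
      by (intro summable_on_cmult_right main_term_summable)
    fix n :: nat assume n: "n \<in> {1..}"
    then have "a n * (euler_prod Q (g n) ?N * (euler_prod (P - Q) (g n) ?N * C)) \<le> a n * ?W (g n)"
      using a_nonneg C density_bounds(1)[of n Q] Q_sub
      by (intro mult_left_mono) (auto simp: less_imp_le)
    then show "C * (a n * sieve_density (g n) P z) \<le> a n * ?W (g n)"
      unfolding sieve_density_eq[OF P_primes] euler_prod_split[OF Q_sub] by (simp add: mult_ac)
  qed
  also have "\<dots> \<le> (\<Sum>\<^sub>\<infinity>n\<in>{1..}. a n * ?W (?i n)) + sieve_error a g P Q z D"
    unfolding id(3) using sum_remainder_le[OF P_primes Q_sub Q_finite D, of False z a g] sq by simp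
  also have "(\<Sum>\<^sub>\<infinity>n\<in>{1..}. a n * ?W (?i n)) \<le> sifted_sum a P z"
    unfolding sifted_sum_eq
  proof (rule infsum_mono[OF id(1) sifted_indicator_summable])
    fix n :: nat assume "n \<in> {1..}"
    then show "a n * ?W (?i n) \<le> a n * euler_prod P (?i n) ?N"
      unfolding euler_prod_split[OF Q_sub] using a_nonneg
      by (intro mult_left_mono sieve_sum_indicator[THEN conjunct2] indicator_nonneg) auto
  qed
  finally show ?thesis by simp
qed

end

theorem theorem11:
  fixes f :: "nat \<Rightarrow> real \<Rightarrow> real"
    and a :: "nat \<Rightarrow> real"
    and g :: "nat \<Rightarrow> nat \<Rightarrow> real"
    and P Q :: "nat set"
    and \<epsilon> :: real
  assumes f: "linear_sieve_system f"
    and a_nonneg: "\<forall>n\<ge>1. a n \<ge> 0"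
    and a_summable: "a summable_on {1..}"
    and P_primes: "\<forall>p\<in>P. prime p"
    and g_mult: "\<forall>n\<ge>1. multiplicative_fun (g n)"
    and g_range: "\<forall>n\<ge>1. \<forall>p\<in>P. 0 \<le> g n p \<and> g n p < 1"
    and Q_sub: "Q \<subseteq> P"
    and Q_finite: "finite Q"
    and eps: "0 < \<epsilon>" "\<epsilon> < 1 / 200"
    and density: "\<forall>n\<ge>1. \<forall>u z. 1 < u \<and> u < z \<longrightarrow>
      (\<Prod>p\<in>{p \<in> P - Q. u \<le> real p \<and> real p < z}. inverse (1 - g n p))
        \<le> (1 + \<epsilon>) * (ln z / ln u)"
  shows "\<forall>z::real. z \<ge> 2 \<longrightarrow>
    (\<forall>D s. D \<ge> z \<and> total_mass a > 0 \<and> s = ln D / ln z \<longrightarrow>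
      sifted_sum a P z
        < (upper_sieve_fun f s + 164 * \<epsilon> * exp 2 * sieve_h s) * sieve_main_term a g P z
          + sieve_error a g P Q z D) \<and>
    (\<forall>D s. D \<ge> z\<^sup>2 \<and> total_mass a > 0 \<and> s = ln D / ln z \<longrightarrow>
      sifted_sum a P z
        > (lower_sieve_fun f s - 162 * \<epsilon> * exp 2 * sieve_h s) * sieve_main_term a g P z
          - sieve_error a g P Q z D) \<and>
    (\<forall>g'. multiplicative_fun g' \<and> (\<forall>n\<ge>1. \<forall>d\<ge>1. g n d = g' d) \<longrightarrow>
      sieve_main_term a g P z = sieve_density g' P z * total_mass a)"
proof (intro allI impI conjI; (elim conjE)?)
  interpret linear_sieve f by unfold_locales (rule f)
  interpret sifted_weights a g P Q
    using a_nonneg a_summable P_primes g_mult g_range Q_sub Q_finite by unfold_locales auto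
  have bounds: "(\<forall>z D. 1 < z \<and> nat \<lceil>z\<rceil> \<le> m \<and> z \<le> D \<longrightarrow>
      sieve_sum (P - Q) (g n) True (nat \<lceil>z\<rceil>) D \<le> euler_prod (P - Q) (g n) (nat \<lceil>z\<rceil>) *
        (1 + odd_sum (Suc m) (ln D / ln z) + \<epsilon> * (161 * hnorm (ln D / ln z)))) \<and>
    (\<forall>z D. 1 < z \<and> nat \<lceil>z\<rceil> \<le> m \<and> z\<^sup>2 \<le> D \<longrightarrow>
      euler_prod (P - Q) (g n) (nat \<lceil>z\<rceil>) *
        (1 - even_sum m (ln D / ln z) - \<epsilon> * (161 * hnorm (ln D / ln z)))
        \<le> sieve_sum (P - Q) (g n) False (nat \<lceil>z\<rceil>) D)" if "1 \<le> n" for n m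
    using that P_primes g_range density eps
    by (intro sieve_sum_bounds) (auto simp: prime_ge_2_nat)
  fix z :: real assume z: "2 \<le> z"
  let ?N = "nat \<lceil>z\<rceil>" and ?X = "sieve_main_term a g P z"
  {
    fix D s :: real assume D: "z \<le> D" and mass: "total_mass a > 0" and s: "s = ln D / ln z"
    have s1: "1 \<le> s" using z D by (simp add: s pos_le_divide_eq)
    define C where "C = 1 + odd_sum (Suc ?N) s + \<epsilon> * (161 * hnorm s)"
    have "sifted_sum a P z \<le> C * ?X + sieve_error a g P Q z D"
      using bounds[of _ ?N] z D by (intro upper_bound) (auto simp: C_def s)
    also have "C * ?X < (upper_sieve_fun f s + 164 * \<epsilon> * exp 2 * sieve_h s) * ?X"
    proof (rule mult_strict_right_mono[OF _ main_term_pos[OF mass]])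
      \<comment> \<open>Strictness: 161 < 164 while epsilon, \<open>hnorm s\<close> and the main
        term are positive.\<close>
      have "\<epsilon> * (161 * hnorm s) < \<epsilon> * (164 * hnorm s)"
        using eps hnorm_pos[OF s1] by (intro mult_strict_left_mono) auto
      then show "C < upper_sieve_fun f s + 164 * \<epsilon> * exp 2 * sieve_h s"
        using odd_sum_le_upper[OF s1, of "Suc ?N"] by (simp add: C_def hnorm_def mult_ac)
    qed
    finally show "sifted_sum a P z < (upper_sieve_fun f s + 164 * \<epsilon> * exp 2 * sieve_h s) * ?X
        + sieve_error a g P Q z D"
      by simp
  next
    fix D s :: real assume D: "z\<^sup>2 \<le> D" and mass: "total_mass a > 0" and s: "s = ln D / ln z"
    have D1: "1 < D" using z D one_less_power[of z 2] by linarith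
    have "ln (z\<^sup>2) \<le> ln D" using z D D1 by (subst ln_le_cancel_iff) auto
    then have s2: "2 \<le> s" using z by (simp add: s pos_le_divide_eq ln_realpow)
    define C where "C = 1 - even_sum ?N s - \<epsilon> * (161 * hnorm s)"
    have "C * ?X - sieve_error a g P Q z D \<le> sifted_sum a P z"
      using bounds[of _ ?N] z D D1 by (intro lower_bound) (auto simp: C_def s)
    moreover have "(lower_sieve_fun f s - 162 * \<epsilon> * exp 2 * sieve_h s) * ?X < C * ?X"
    proof (rule mult_strict_right_mono[OF _ main_term_pos[OF mass]])
      have "\<epsilon> * (161 * hnorm s) < \<epsilon> * (162 * hnorm s)"
        using eps hnorm_pos[of s] s2 by (intro mult_strict_left_mono) auto
      then show "lower_sieve_fun f s - 162 * \<epsilon> * exp 2 * sieve_h s < C"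
        using lower_le_even_sum[OF s2, of ?N] by (simp add: C_def hnorm_def mult_ac)
    qed
    ultimately show "(lower_sieve_fun f s - 162 * \<epsilon> * exp 2 * sieve_h s) * ?X
        - sieve_error a g P Q z D < sifted_sum a P z"
      by simp
  next
    fix g' assume g': "\<forall>n\<ge>1. \<forall>d\<ge>1. g n d = g' d"
    have "sieve_density (g n) P z = sieve_density g' P z" if "1 \<le> n" for n
      unfolding sieve_density_def
    proof (intro prod.cong refl)
      fix p assume "p \<in> {p. prime p \<and> p dvd sieve_prod P z}"
      then have "1 \<le> p" using prime_ge_1_nat by blast
      then show "1 - g n p = 1 - g' p" using g' that by simp
    qed
    then have "?X = (\<Sum>\<^sub>\<infinity>n\<in>{1..}. sieve_density g' P z * a n)"
      unfolding sieve_main_term_def by (intro infsum_cong) simp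
    then show "?X = sieve_density g' P z * total_mass a"
      by (simp add: total_mass_def infsum_cmult_right')
  }
qed

end
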